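(* Assume that the linear evolution process $\{L(t,\tau)\colon t\ge\tau\}$ generated by $u_t=A(t)u$ on the Banach space $X$ has exponential splitting with bound $M\ge 1$, exponents $\gamma>\rho$ and projections $\{Q(\tau)\colon\tau\in\mathbb R\}$. Let $\Gamma$ be an admissible norm on $\mathbb R^2$, and let $f\colon\mathbb R\times X\to X$ be continuous, with $f(t,0)=0$ for all $t$, satisfying the Lipschitz conditions (with respect to the norms $|\cdot|_{N(t)}$, $|\cdot|_{S(t)}$, $\|\cdot\|_t$) with constants $L_1,L_2>0$. Assume that $u_t=A(t)u+f(t,u)$ generates an evolution process $\{T(t,\tau)\colon t\ge\tau\}$ in $X$ satisfying $$T(t,\tau)\eta=L(t,\tau)\eta+\int_\tau^tL(t,s)f(s,T(s,\tau)\eta)\,ds,\qquad t\ge\tau,\ \eta\in X,$$ and that $\Gamma\left(\frac{L_1}{\sigma-\rho},\frac{L_2}{\gamma-\sigma}\right)<1$ for some $\sigma\in(\rho,\gamma)$. Then there exists a family of sets $\{\mathcal S(t)\colon t\in\mathbb R\}$ (the stable manifold complementary to the invariant manifold $\{\mathcal M(t)\}$), positively invariant, i.e. $T(t,\tau)\mathcal S(\tau)\subset\mathcal S(t)$ for $t\ge\tau$, given by $$\mathcal S(t)=\Big\{\eta\in X\colon\sup_{r\ge t}e^{\sigma r}\|T(r,t)\eta\|_r<\infty\Big\},\qquad t\in\mathbb R.$$ Moreover $\mathcal S(t)=P_\Theta(t)X$, where $P_\Theta(t)u=\Theta(t,u)+(I-Q(t))u$ for $(t,u)\in\mathbb R\times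 X$ and $\Theta\colon\mathbb R\times X\to X$ is a function such that (1) $\Theta(t,u)=\Theta(t,(I-Q(t))u)=Q(t)\Theta(t,u)$ and $\Theta(t,0)=0$ for every $t\in\mathbb R$, $u\in X$; (2) $|\Theta(t,\eta)-\Theta(t,\tilde\eta)|_{N(t)}\le\kappa_\Theta|(I-Q(t))(\eta-\tilde\eta)|_{S(t)}$ for every $t\in\mathbb R$ and $\eta,\tilde\eta\in X$, with a constant $0<\kappa_\Theta<\frac{L_1}{L_2}\frac{\gamma-\sigma}{\sigma-\rho}$ satisfying $$\gamma-\rho=L_1\Gamma\left(1,\tfrac1{\kappa_\Theta}\right)+L_2\Gamma(\kappa_\Theta,1).$$ In addition, $$\|T(t,\tau)P_\Theta(\tau)u\|_t\le\frac{\Gamma(\kappa_\Theta,1)}{\Gamma(0,1)}e^{-(\gamma-L_2\Gamma(\kappa_\Theta,1))(t-\tau)}\|P_\Theta(\tau)u\|_\tau\quad\text{for every } t\ge\tau,\ u\in X.$$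
   Context: Setting. $(X,\|\cdot\|)$ is a Banach space, $\mathcal L(X)$ the bounded linear operators on $X$, $J=\{(t,\tau)\in\mathbb R^2\colon t\ge\tau\}$. A linear evolution process is a family $\{L(t,\tau)\colon(t,\tau)\in J\}\subset\mathcal L(X)$ with $L(t,\tau)=L(t,s)L(s,\tau)$ for $t\ge s\ge\tau$, $L(t,t)=I$, and $J\ni(t,\tau)\mapsto L(t,\tau)\eta\in X$ continuous for each $\eta\in X$. The (possibly unbounded) linear operators $A(t)$, $t\in\mathbb R$, generate such a process: $t\mapsto L(t,\tau)\eta$ is the mild solution of $u_t=A(t)u$, $u(\tau)=\eta$. Exponential splitting with bound $M\ge1$, exponents $\gamma>\rho$ and projections $Q(t)\in\mathcal L(X)$: (i) $Q(t)L(t,\tau)=L(t,\tau)Q(\tau)$ for $t\ge\tau$; (ii) $L(t,\tau)|_{Q(\tau)X}\colon Q(\tau)X\to Q(t)X$ is an isomorphism for $t\ge\tau$, with inverse denoted $L(\tau,t)\colon Q(t)X\to Q(\tau)X$; (iii) $e^{\gamma(t-\tau)}\|L(t,\tau)(I-Q(\tau))\|\le M$ for $t\ge\tau$ and $e^{\rho(t-\tau)}\|L(t,\tau)Q(\tau)\|\le M$ for $t\le\tau$. Norms. $N(\tau)=Q(\tau)X$, $S(\tau)=(I-Q(\tau))X$; $|x|_{N(\tau)}=\sup_{t\le\tau}e^{\rho(t-\tau)}\|L(t,\tau)x\|$ for $x\in N(\tau)$; $|x|_{S(\tau)}=\sup_{t\ge\tau}e^{\gamma(t-\tau)}\|L(t,\tau)x\|$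 for $x\in S(\tau)$. A norm $\Gamma\colon\mathbb R^2\to[0,\infty)$ is admissible if for all $a,b\ge0$ the functions $\Gamma(a,\cdot)$ and $\Gamma(\cdot,b)$ are non-decreasing on $[0,\infty)$. For such $\Gamma$, $\|x\|_\tau=\Gamma(|Q(\tau)x|_{N(\tau)},|(I-Q(\tau))x|_{S(\tau)})$, an equivalent norm on $X$. Lipschitz conditions: for all $t\in\mathbb R$, $u,v\in X$, $|Q(t)(f(t,u)-f(t,v))|_{N(t)}\le L_1\|u-v\|_t$ and $|(I-Q(t))(f(t,u)-f(t,v))|_{S(t)}\le L_2\|u-v\|_t$. Nonlinear process: maps $T(t,\tau)\colon X\to X$, $t\ge\tau$, with $T(t,t)=I$, $T(t,s)T(s,\tau)=T(t,\tau)$ for $t\ge s\ge\tau$, and $t\mapsto T(t,\tau)\eta$ continuous on $[\tau,\infty)$. The invariant manifold mentioned in the name of $\mathcal S$ is $\mathcal M(t)=\{\eta\in X\colon$ there is $z\colon\mathbb R\to X$ with $T(r,s)z(s)=z(r)$ for $r\ge s$, $z(t)=\eta$ and $\sup_{r\le t}e^{\sigma r}\|z(r)\|_r<\infty\}$; it plays no further role in the statement. *)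

theory Defs
  imports "HOL-Analysis.Analysis"
begin

text \<open>Processes are total functions of two real arguments; only their values at
  \<open>(t, \<tau>)\<close> with \<open>\<tau> \<le> t\<close> are constrained or used.\<close>

definition linear_evolution_process ::
    "(real \<Rightarrow> real \<Rightarrow> ('a::banach \<Rightarrow>\<^sub>L 'a)) \<Rightarrow> bool" where
  "linear_evolution_process L \<longleftrightarrow>
     (\<forall>t s \<tau>. \<tau> \<le> s \<longrightarrow> s \<le> t \<longrightarrow> L t \<tau> = L t s o\<^sub>L L s \<tau>) \<and>
     (\<forall>t. L t t = id_blinfun) \<and>
     (\<forall>\<eta>. continuous_on {(t, \<tau>). \<tau> \<le> t} (\<lambda>(t, \<tau>). L t \<tau> \<eta>))"

definition evolution_process :: "(real \<Rightarrow> real \<Rightarrow> 'a::banach \<Rightarrow> 'a) \<Rightarrow> bool" where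
  "evolution_process T \<longleftrightarrow>
     (\<forall>t \<eta>. T t t \<eta> = \<eta>) \<and>
     (\<forall>t s \<tau> \<eta>. \<tau> \<le> s \<longrightarrow> s \<le> t \<longrightarrow> T t s (T s \<tau> \<eta>) = T t \<tau> \<eta>) \<and>
     (\<forall>\<tau> \<eta>. continuous_on {\<tau>..} (\<lambda>t. T t \<tau> \<eta>))"

text \<open>The operator \<open>L(t, \<tau>)\<close> extended to \<open>t < \<tau>\<close>, where it is the inverse of
  \<open>L(\<tau>, t) : Q(t)X \<rightarrow> Q(\<tau>)X\<close> and is meaningful on \<open>Q(\<tau>)X\<close> only.\<close>

definition two_sided ::
    "(real \<Rightarrow> real \<Rightarrow> ('a::banach \<Rightarrow>\<^sub>L 'a)) \<Rightarrow> (real \<Rightarrow> ('a \<Rightarrow>\<^sub>L 'a)) \<Rightarrow> real \<Rightarrow> real \<Rightarrow> 'a \<Rightarrow> 'a" where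
  "two_sided L Q t \<tau> x =
     (if \<tau> \<le> t then L t \<tau> x else inv_into (range (Q t)) (L \<tau> t) x)"

text \<open>The homeomorphism clause says that the linear map \<open>L(t, \<tau>)\<close> restricts to an isomorphism
  of normed spaces \<open>Q(\<tau>)X \<rightarrow> Q(t)X\<close>. Consequently the argument of \<^const>\<open>onorm\<close> is a bounded
  linear operator.\<close>

definition exponential_splitting ::
    "(real \<Rightarrow> real \<Rightarrow> ('a::banach \<Rightarrow>\<^sub>L 'a)) \<Rightarrow> (real \<Rightarrow> ('a \<Rightarrow>\<^sub>L 'a)) \<Rightarrow> real \<Rightarrow> real \<Rightarrow> real \<Rightarrow> bool" where
  "exponential_splitting L Q M \<gamma> \<rho> \<longleftrightarrow>
     1 \<le> M \<and> \<rho> < \<gamma> \<and>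
     (\<forall>t. Q t o\<^sub>L Q t = Q t) \<and>
     (\<forall>t \<tau>. \<tau> \<le> t \<longrightarrow> Q t o\<^sub>L L t \<tau> = L t \<tau> o\<^sub>L Q \<tau>) \<and>
     (\<forall>t \<tau>. \<tau> \<le> t \<longrightarrow>
        homeomorphism (range (Q \<tau>)) (range (Q t)) (L t \<tau>) (inv_into (range (Q \<tau>)) (L t \<tau>))) \<and>
     (\<forall>t \<tau>. \<tau> \<le> t \<longrightarrow> exp (\<gamma> * (t - \<tau>)) * norm (L t \<tau> o\<^sub>L (id_blinfun - Q \<tau>)) \<le> M) \<and>
     (\<forall>t \<tau>. t \<le> \<tau> \<longrightarrow> exp (\<rho> * (t - \<tau>)) * onorm (\<lambda>x. two_sided L Q t \<tau> (Q \<tau> x)) \<le> M)"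

text \<open>Used for \<open>x \<in> Q(\<tau>)X\<close> and \<open>x \<in> (I - Q(\<tau>))X\<close> respectively; under an exponential splitting
  the suprema are over sets bounded by \<open>M * norm x\<close>.\<close>

definition N_norm ::
    "(real \<Rightarrow> real \<Rightarrow> ('a::banach \<Rightarrow>\<^sub>L 'a)) \<Rightarrow> (real \<Rightarrow> ('a \<Rightarrow>\<^sub>L 'a)) \<Rightarrow> real \<Rightarrow> real \<Rightarrow> 'a \<Rightarrow> real" where
  "N_norm L Q \<rho> \<tau> x = (SUP t\<in>{..\<tau>}. exp (\<rho> * (t - \<tau>)) * norm (two_sided L Q t \<tau> x))"

definition S_norm ::
    "(real \<Rightarrow> real \<Rightarrow> ('a::banach \<Rightarrow>\<^sub>L 'a)) \<Rightarrow> real \<Rightarrow> real \<Rightarrow> 'a \<Rightarrow> real" where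
  "S_norm L \<gamma> \<tau> x = (SUP t\<in>{\<tau>..}. exp (\<gamma> * (t - \<tau>)) * norm (L t \<tau> x))"

definition admissible_norm :: "(real \<times> real \<Rightarrow> real) \<Rightarrow> bool" where
  "admissible_norm \<Gamma> \<longleftrightarrow>
     (\<forall>p. 0 \<le> \<Gamma> p) \<and>
     (\<forall>p. \<Gamma> p = 0 \<longleftrightarrow> p = 0) \<and>
     (\<forall>c p. \<Gamma> (c *\<^sub>R p) = \<bar>c\<bar> * \<Gamma> p) \<and>
     (\<forall>p q. \<Gamma> (p + q) \<le> \<Gamma> p + \<Gamma> q) \<and>
     (\<forall>a\<ge>0. mono_on {0..} (\<lambda>b. \<Gamma> (a, b))) \<and>
     (\<forall>b\<ge>0. mono_on {0..} (\<lambda>a. \<Gamma> (a, b)))"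

definition adapted_norm ::
    "(real \<times> real \<Rightarrow> real) \<Rightarrow> (real \<Rightarrow> real \<Rightarrow> ('a::banach \<Rightarrow>\<^sub>L 'a)) \<Rightarrow> (real \<Rightarrow> ('a \<Rightarrow>\<^sub>L 'a)) \<Rightarrow>
     real \<Rightarrow> real \<Rightarrow> real \<Rightarrow> 'a \<Rightarrow> real" where
  "adapted_norm \<Gamma> L Q \<gamma> \<rho> \<tau> x =
     \<Gamma> (N_norm L Q \<rho> \<tau> (Q \<tau> x), S_norm L \<gamma> \<tau> (x - Q \<tau> x))"

definition graph_map ::
    "(real \<Rightarrow> ('a::banach \<Rightarrow>\<^sub>L 'a)) \<Rightarrow> (real \<Rightarrow> 'a \<Rightarrow> 'a) \<Rightarrow> real \<Rightarrow> 'a \<Rightarrow> 'a" where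
  "graph_map Q \<Theta> t u = \<Theta> t u + (u - Q t u)"

end

theory Submission
  imports Defs
begin

text \<open>In the adapted norms the linear flow is \<open>exp (- \<gamma> t)\<close>-contracting forwards on \<open>S\<close> and
  \<open>exp (\<rho> t)\<close>-bounded backwards on \<open>N\<close> with constant 1, so the Lyapunov--Perron operator for
  \<open>\<sigma>\<close>-decaying orbits with prescribed \<open>S\<close>-component is a contraction with factor
  \<open>\<Gamma>(L1 / (\<sigma> - \<rho>), L2 / (\<gamma> - \<sigma>)) < 1\<close>. Its fixed point is the orbit of the one point of the stable set above
  that component. The slope equation for \<open>\<kappa>\<close>, solved by the intermediate value theorem, says precisely
  that \<open>(\<kappa>, 1) exp (- \<beta> t)\<close> with \<open>\<beta> = \<gamma> - L2 \<Gamma>(\<kappa>, 1) > \<sigma>\<close> is invariant under the corresponding scalar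
  operator. Comparing the difference of two \<open>\<sigma>\<close>-decaying orbits with it yields the Lipschitz estimate
  and the decay rate at once.\<close>

text \<open>Two obstacles shape the proof. The flow is invertible only on the unstable spaces, so
  the integral over \<open>[t, \<infinity>)\<close> is approached through finite horizons: the
  endpoint value \<open>w b\<close> is pulled back by \<open>B t b\<close>, and \<sigma>-decay with
  \<open>\<rho> < \<sigma>\<close> removes this boundary term as \<open>b\<close> runs through
  \<open>\<tau> + n\<close>. All functions compared therefore obey one forward formula,
  \<open>voc\<close>. Secondly, the norm \<open>nX t\<close> changes with \<open>t\<close>, and only
  its uniform equivalence with the norm of \<open>X\<close> is available. Integrals are thus
  estimated by explicit exponential majorants, and the contraction property is kept pointwise in
  time; Banach's theorem is applied in the ordinary sup norm to an iterate that absorbs the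
  equivalence constants. The slope equation comes from asking which rate \<beta> and slope \<kappa>
  reproduce the profile \<open>(\<kappa>, 1) exp (- \<beta> t)\<close>: its components demand
  \<open>\<beta> - \<rho> = L1 \<Gamma>(\<kappa>, 1) / \<kappa>\<close> and
  \<open>\<gamma> - \<beta> = L2 \<Gamma>(\<kappa>, 1)\<close>, and adding the two eliminates
  \<beta>.\<close>

lemma cSUP_seminorm_triangle:
  fixes f g h :: "'i \<Rightarrow> real"
  assumes "I \<noteq> {}" "bdd_above (f ` I)" "bdd_above (g ` I)" "\<And>i. i \<in> I \<Longrightarrow> h i \<le> f i + g i"
  shows "(SUP i\<in>I. h i) \<le> (SUP i\<in>I. f i) + (SUP i\<in>I. g i)"
proof (rule cSUP_least[OF assms(1)])
  fix i assume "i \<in> I"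
  then show "h i \<le> (SUP i\<in>I. f i) + (SUP i\<in>I. g i)"
    using assms(4)[of i] cSUP_upper[OF _ assms(2), of i] cSUP_upper[OF _ assms(3), of i] by linarith
qed

section \<open>Splittings and adapted norms\<close>

locale splitting =
  fixes L :: "real \<Rightarrow> real \<Rightarrow> ('a::banach \<Rightarrow>\<^sub>L 'a)"
    and Q :: "real \<Rightarrow> ('a \<Rightarrow>\<^sub>L 'a)"
    and M \<gamma> \<rho> :: real
  assumes process: "linear_evolution_process L"
    and splits: "exponential_splitting L Q M \<gamma> \<rho>"
begin

text \<open>\<open>B t s\<close> is the paper's \<open>L(t, s) Q(s)\<close> for \<open>t \<le> s\<close>, the flow backwards in time.\<close>

definition B :: "real \<Rightarrow> real \<Rightarrow> 'a \<Rightarrow> 'a" where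
  "B t s x = two_sided L Q t s (Q s x)"

text \<open>Projecting first yields a seminorm on all of \<open>X\<close>, whereas
  \<open>N_norm\<close> is meant for points of \<open>Q(t)X\<close>. The same holds for
  \<open>nS\<close> and \<open>S_norm\<close>.\<close>

definition nN :: "real \<Rightarrow> 'a \<Rightarrow> real" where
  "nN t x = N_norm L Q \<rho> t (Q t x)"

definition nS :: "real \<Rightarrow> 'a \<Rightarrow> real" where
  "nS t x = S_norm L \<gamma> t (x - Q t x)"

section \<open>Algebra of the flow and of its backward extension\<close>

lemma L_comp: "\<tau> \<le> s \<Longrightarrow> s \<le> t \<Longrightarrow> L t s (L s \<tau> x) = L t \<tau> x"
  using process unfolding linear_evolution_process_def by (metis blinfun_apply_blinfun_compose)

lemma L_refl [simp]: "L t t x = x"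
  using process unfolding linear_evolution_process_def by simp

lemma L_cont: "continuous_on {(t, \<tau>). \<tau> \<le> t} (\<lambda>(t, \<tau>). L t \<tau> x)"
  using process unfolding linear_evolution_process_def by simp

lemma M_ge_1: "1 \<le> M" and rho_less_gamma: "\<rho> < \<gamma>"
  using splits unfolding exponential_splitting_def by auto

lemma Q_idem [simp]: "Q t (Q t x) = Q t x"
  using splits unfolding exponential_splitting_def by (metis blinfun_apply_blinfun_compose)

lemma QL: "s \<le> t \<Longrightarrow> Q t (L t s x) = L t s (Q s x)"
  using splits unfolding exponential_splitting_def by (metis blinfun_apply_blinfun_compose)

lemma L_homeo: "s \<le> t \<Longrightarrow> homeomorphism (range (Q s)) (range (Q t)) (L t s) (inv_into (range (Q s)) (L t s))"
  using splits unfolding exponential_splitting_def by blast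

lemma L_stable: 
  assumes "s \<le> t" shows "exp (\<gamma> * (t - s)) * norm (L t s (x - Q s x)) \<le> M * norm x"
proof -
  have "norm ((L t s o\<^sub>L (id_blinfun - Q s)) x) \<le> norm (L t s o\<^sub>L (id_blinfun - Q s)) * norm x"
    by (rule norm_blinfun)
  then have "exp (\<gamma> * (t - s)) * norm (L t s (x - Q s x))
      \<le> exp (\<gamma> * (t - s)) * norm (L t s o\<^sub>L (id_blinfun - Q s)) * norm x"
    by (simp add: minus_blinfun.rep_eq)
  also have "\<dots> \<le> M * norm x"
    using splits assms unfolding exponential_splitting_def by (intro mult_right_mono) auto
  finally show ?thesis .
qed

lemma Q_B [simp]: "t \<le> s \<Longrightarrow> Q t (B t s x) = B t s x"
  and L_B: "t \<le> s \<Longrightarrow> L s t (B t s x) = Q s x"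
proof -
  assume ts: "t \<le> s"
  have im: "L s t ` range (Q t) = range (Q s)"
    using L_homeo[OF ts] unfolding homeomorphism_def by auto
  \<comment> \<open>At \<open>t = s\<close> the forward branch of \<open>two_sided\<close> applies,
    so agreement with the inverse is checked separately.\<close>
  have *: "B t s x = inv_into (range (Q t)) (L s t) (Q s x)"
  proof (cases "t = s")
    case True
    have "inv_into (range (Q s)) (L s s) (Q s x) \<in> range (Q s)"
      by (rule inv_into_into) auto
    moreover have "L s s (inv_into (range (Q s)) (L s s) (Q s x)) = Q s x"
      by (rule f_inv_into_f) auto
    ultimately show ?thesis using True by (simp add: B_def two_sided_def)
  qed (use ts in \<open>simp add: B_def two_sided_def\<close>)
  show "L s t (B t s x) = Q s x" unfolding * by (rule f_inv_into_f) (simp only: im, simp)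
  have "B t s x \<in> range (Q t)" unfolding * by (rule inv_into_into) (simp only: im, simp)
  then show "Q t (B t s x) = B t s x" by auto
qed

text \<open>Injectivity of \<open>L s t\<close> on \<open>Q(t)X\<close> characterises backward
  values; the algebra of \<open>B\<close> below reduces to checking these equations.\<close>

lemma B_unique:
  assumes "t \<le> s" "Q t y = y" "L s t y = Q s x" shows "B t s x = y"
proof -
  have inj: "inj_on (L s t) (range (Q t))"
    using L_homeo[OF assms(1)] unfolding homeomorphism_def by (metis inj_on_inverseI)
  show ?thesis
  proof (rule inj_onD[OF inj])
    show "B t s x \<in> range (Q t)" using Q_B[OF assms(1), of x] by (metis rangeI)
    show "y \<in> range (Q t)" using assms(2) by (metis rangeI)
  qed (simp add: assms L_B)
qed

lemma B_refl: "B t t x = Q t x"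
  by (rule B_unique) auto

lemma B_L: "t \<le> s \<Longrightarrow> s \<le> r \<Longrightarrow> B t r (L r s x) = B t s x"
  by (rule B_unique) (auto simp: QL L_B simp flip: L_comp[of t s r])

lemma B_L_forward: "s \<le> t \<Longrightarrow> t \<le> r \<Longrightarrow> B t r (L r s x) = L t s (Q s x)"
  by (rule B_unique) (auto simp: QL L_comp)

lemma B_B: "r \<le> t \<Longrightarrow> t \<le> s \<Longrightarrow> B r t (B t s x) = B r s x"
  by (rule B_unique[symmetric]) (auto simp: L_B, metis L_B L_comp Q_B)

lemma L_B_backward: "t \<le> s \<Longrightarrow> s \<le> r \<Longrightarrow> L s t (B t r x) = B s r x"
  by (rule B_unique[symmetric]) (auto simp: QL L_B L_comp)

lemma linear_B: assumes "t \<le> s" shows "linear (B t s)"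
proof (rule linearI)
  fix x y :: 'a and c :: real
  show "B t s (x + y) = B t s x + B t s y"
    by (rule B_unique) (use assms in \<open>auto simp: blinfun.add_right L_B\<close>)
  show "B t s (c *\<^sub>R x) = c *\<^sub>R B t s x"
    by (rule B_unique) (use assms in \<open>auto simp: blinfun.scaleR_right L_B\<close>)
qed

lemma continuous_B: assumes "t \<le> s" shows "continuous_on UNIV (B t s)"
proof -
  let ?h = "inv_into (range (Q t)) (L s t)"
  have "continuous_on (range (Q s)) ?h"
    using L_homeo[OF assms] unfolding homeomorphism_def by auto
  then have "continuous_on UNIV (\<lambda>x. ?h (Q s x))"
    by (rule continuous_on_compose2) (auto intro: continuous_intros)
  moreover have "?h (Q s x) = B t s x" for x
  proof (rule B_unique[OF assms, symmetric])
    have im: "L s t ` range (Q t) = range (Q s)"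
      using L_homeo[OF assms] unfolding homeomorphism_def by auto
    show "L s t (?h (Q s x)) = Q s x" by (rule f_inv_into_f) (simp only: im, simp)
    have "?h (Q s x) \<in> range (Q t)" by (rule inv_into_into) (simp only: im, simp)
    then show "Q t (?h (Q s x)) = ?h (Q s x)" by auto
  qed
  ultimately show ?thesis by simp
qed

text \<open>Makes the \<open>onorm\<close> bound of the splitting usable. The homeomorphism gives
  continuity at 0, and rescaling \<open>x\<close> to norm \<open>d / 2\<close> turns it into the
  bound \<open>2 / d\<close>.\<close>

lemma bounded_linear_B: assumes "t \<le> s" shows "bounded_linear (B t s)"
proof -
  interpret linear "B t s" by (rule linear_B[OF assms])
  have "isCont (B t s) 0"
    using continuous_B[OF assms] by (simp add: continuous_on_eq_continuous_at)
  then have "\<exists>d>0. \<forall>y. dist y 0 < d \<longrightarrow> dist (B t s y) (B t s 0) < 1"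
    unfolding continuous_at_eps_delta by (metis zero_less_one)
  then obtain d where d: "d > 0" "\<And>y. norm y < d \<Longrightarrow> norm (B t s y) < 1"
    by (auto simp: zero)
  have "norm (B t s x) \<le> norm x * (2 / d)" for x
  proof (cases "x = 0")
    case False
    define c where "c = d / (2 * norm x)"
    have c: "c > 0" using False d by (simp add: c_def)
    have "norm (c *\<^sub>R x) < d" using False d c by (simp add: c_def)
    then have "norm (B t s (c *\<^sub>R x)) < 1" by (rule d)
    then have "c * norm (B t s x) < 1" using c by (simp add: scale)
    then show ?thesis using False d(1) by (simp add: c_def field_simps)
  qed (simp add: zero)
  then show ?thesis
    by (intro bounded_linear_intro[of _ "2/d"]) (auto simp: add scale)
qed

lemma B_bound:
  assumes "t \<le> s" shows "exp (\<rho> * (t - s)) * norm (B t s x) \<le> M * norm x"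
proof -
  have "exp (\<rho> * (t - s)) * norm (B t s x) \<le> exp (\<rho> * (t - s)) * (onorm (B t s) * norm x)"
    by (intro mult_left_mono onorm bounded_linear_B assms) auto
  also have "\<dots> = (exp (\<rho> * (t - s)) * onorm (B t s)) * norm x" by simp
  also have "\<dots> \<le> M * norm x"
    using splits assms unfolding exponential_splitting_def B_def by (intro mult_right_mono) auto
  finally show ?thesis .
qed

lemma B_bound': "t \<le> s \<Longrightarrow> norm (B t s x) \<le> M * exp (\<rho> * (s - t)) * norm x"
  using B_bound[of t s x] by (simp add: algebra_simps exp_diff field_simps exp_minus)

lemma L_stable': "s \<le> t \<Longrightarrow> norm (L t s (x - Q s x)) \<le> M * exp (- \<gamma> * (t - s)) * norm x"
  using L_stable[of s t x] by (simp add: algebra_simps exp_diff field_simps exp_minus)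

section \<open>The adapted seminorm of the unstable component\<close>

lemma nN_alt: "nN t x = (SUP r\<in>{..t}. exp (\<rho> * (r - t)) * norm (B r t x))"
  by (simp add: nN_def N_norm_def B_def)

lemma bdd_nN: "bdd_above ((\<lambda>r. exp (\<rho> * (r - t)) * norm (B r t x)) ` {..t})"
  by (rule bdd_aboveI2[where M = "M * norm x"]) (auto intro: B_bound)

lemma nN_upper: "r \<le> t \<Longrightarrow> exp (\<rho> * (r - t)) * norm (B r t x) \<le> nN t x"
  unfolding nN_alt by (rule cSUP_upper[OF _ bdd_nN]) auto

lemma nN_least: "(\<And>r. r \<le> t \<Longrightarrow> exp (\<rho> * (r - t)) * norm (B r t x) \<le> c) \<Longrightarrow> nN t x \<le> c"
  unfolding nN_alt by (rule cSUP_least) auto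

lemma nN_le_norm: "nN t x \<le> M * norm x"
  by (rule nN_least) (rule B_bound)

lemma norm_Q_le_nN: "norm (Q t x) \<le> nN t x"
  using nN_upper[of t t x] by (simp add: B_refl)

lemma nN_nonneg [simp]: "0 \<le> nN t x"
  using norm_Q_le_nN[of t x] norm_ge_zero order_trans by blast

lemma nN_add: "nN t (x + y) \<le> nN t x + nN t y"
  unfolding nN_alt
proof (rule cSUP_seminorm_triangle)
  fix r assume "r \<in> {..t}"
  then have "B r t (x + y) = B r t x + B r t y" using linear_B[of r t] by (simp add: linear_add)
  then show "exp (\<rho> * (r - t)) * norm (B r t (x + y)) \<le>
      exp (\<rho> * (r - t)) * norm (B r t x) + exp (\<rho> * (r - t)) * norm (B r t y)"
    by (simp add: norm_triangle_ineq flip: distrib_left)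
qed (auto intro: bdd_nN)

text \<open>Times before \<open>t\<close> are also before \<open>s\<close>, so up to the weight this
  supremum is part of the one defining \<open>nN s x\<close>. That is how the constant
  \<open>M\<close> disappears; \<open>nS_L\<close> is the mirror image.\<close>

lemma nN_B: assumes "t \<le> s" shows "nN t (B t s x) \<le> exp (\<rho> * (s - t)) * nN s x"
proof (rule nN_least)
  fix r assume r: "r \<le> t"
  have "exp (\<rho> * (r - t)) = exp (\<rho> * (s - t)) * exp (\<rho> * (r - s))"
    by (simp add: algebra_simps flip: exp_add)
  then have "exp (\<rho> * (r - t)) * norm (B r t (B t s x)) =
      exp (\<rho> * (s - t)) * (exp (\<rho> * (r - s)) * norm (B r s x))"
    using assms r by (simp add: B_B)
  also have "\<dots> \<le> exp (\<rho> * (s - t)) * nN s x"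
    using assms r by (intro mult_left_mono nN_upper) auto
  finally show "exp (\<rho> * (r - t)) * norm (B r t (B t s x)) \<le> exp (\<rho> * (s - t)) * nN s x" .
qed

lemma nN_zero [simp]: "nN t 0 = 0"
  using nN_le_norm[of t 0] nN_nonneg[of t 0] by (simp del: nN_nonneg)

lemma nN_eq_0: "nN t x = 0 \<Longrightarrow> Q t x = 0"
  using norm_Q_le_nN[of t x] by simp

lemma nN_Q [simp]: "nN t (Q t x) = nN t x"
  by (simp add: nN_def)

section \<open>The adapted seminorm of the stable component\<close>

lemma bdd_nS: "bdd_above ((\<lambda>r. exp (\<gamma> * (r - t)) * norm (L r t (x - Q t x))) ` {t..})"
  by (rule bdd_aboveI2[where M = "M * norm x"]) (auto intro: L_stable)

lemma nS_upper: "t \<le> r \<Longrightarrow> exp (\<gamma> * (r - t)) * norm (L r t (x - Q t x)) \<le> nS t x"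
  unfolding nS_def S_norm_def by (rule cSUP_upper[OF _ bdd_nS]) auto

lemma nS_least: "(\<And>r. t \<le> r \<Longrightarrow> exp (\<gamma> * (r - t)) * norm (L r t (x - Q t x)) \<le> c) \<Longrightarrow> nS t x \<le> c"
  unfolding nS_def S_norm_def by (rule cSUP_least) auto

lemma nS_le_norm: "nS t x \<le> M * norm x"
  by (rule nS_least) (rule L_stable)

lemma norm_compl_le_nS: "norm (x - Q t x) \<le> nS t x"
  using nS_upper[of t t x] by simp

lemma nS_nonneg [simp]: "0 \<le> nS t x"
  using norm_compl_le_nS[of x t] norm_ge_zero order_trans by blast

lemma nS_add: "nS t (x + y) \<le> nS t x + nS t y"
  unfolding nS_def S_norm_def
proof (rule cSUP_seminorm_triangle)
  fix r
  have "L r t (x + y - Q t (x + y)) = L r t (x - Q t x) + L r t (y - Q t y)"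
    by (simp add: blinfun.diff_right blinfun.add_right)
  then show "exp (\<gamma> * (r - t)) * norm (L r t (x + y - Q t (x + y))) \<le>
      exp (\<gamma> * (r - t)) * norm (L r t (x - Q t x)) + exp (\<gamma> * (r - t)) * norm (L r t (y - Q t y))"
    by (simp add: norm_triangle_ineq flip: distrib_left)
qed (auto intro: bdd_nS)

lemma nS_L: assumes "s \<le> t" shows "nS t (L t s x) \<le> exp (- \<gamma> * (t - s)) * nS s x"
proof (rule nS_least)
  fix r assume r: "t \<le> r"
  have "exp (\<gamma> * (r - t)) = exp (- \<gamma> * (t - s)) * exp (\<gamma> * (r - s))"
    by (simp add: algebra_simps flip: exp_add)
  moreover have "L r t (L t s x - Q t (L t s x)) = L r s (x - Q s x)"
    using assms r by (simp add: QL L_comp blinfun.diff_right)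
  ultimately have "exp (\<gamma> * (r - t)) * norm (L r t (L t s x - Q t (L t s x))) =
      exp (- \<gamma> * (t - s)) * (exp (\<gamma> * (r - s)) * norm (L r s (x - Q s x)))"
    by simp
  also have "\<dots> \<le> exp (- \<gamma> * (t - s)) * nS s x"
    using assms r by (intro mult_left_mono nS_upper) auto
  finally show "exp (\<gamma> * (r - t)) * norm (L r t (L t s x - Q t (L t s x))) \<le> exp (- \<gamma> * (t - s)) * nS s x" .
qed

lemma nS_zero [simp]: "nS t 0 = 0"
  using nS_le_norm[of t 0] nS_nonneg[of t 0] by (simp del: nS_nonneg)

lemma norm_le_nN_nS: "norm x \<le> nN t x + nS t x"
  using norm_triangle_ineq[of "Q t x" "x - Q t x"] norm_Q_le_nN[of t x] norm_compl_le_nS[of x t] by simp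

lemma nN_minus: "nN t (- x) = nN t x"
proof -
  have "exp (\<rho> * (r - t)) * norm (B r t (- x)) = exp (\<rho> * (r - t)) * norm (B r t x)" if "r \<in> {..t}" for r
    using linear_neg[OF linear_B[of r t], of x] that by simp
  then show ?thesis unfolding nN_alt by (rule SUP_cong[OF refl])
qed

lemma nS_minus: "nS t (- x) = nS t x"
proof -
  have "- x - Q t (- x) = - (x - Q t x)" by (simp add: blinfun.minus_right)
  then have "norm (L r t (- x - Q t (- x))) = norm (L r t (x - Q t x))" for r
    by (metis blinfun.minus_right norm_minus_cancel)
  then show ?thesis unfolding nS_def S_norm_def by presburger
qed

lemma nN_scale: assumes "0 < c" shows "nN t (c *\<^sub>R x) = c * nN t x"
proof -
  have le: "nN t (c *\<^sub>R x) \<le> c * nN t x" if "0 < c" for c x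
  proof (rule nN_least)
    fix r assume r: "r \<le> t"
    have "exp (\<rho> * (r - t)) * norm (B r t (c *\<^sub>R x)) = c * (exp (\<rho> * (r - t)) * norm (B r t x))"
      using that linear_scale[OF linear_B[OF r], of c x] by simp
    also have "\<dots> \<le> c * nN t x" using that r by (intro mult_left_mono nN_upper) auto
    finally show "exp (\<rho> * (r - t)) * norm (B r t (c *\<^sub>R x)) \<le> c * nN t x" .
  qed
  have "nN t x \<le> inverse c * nN t (c *\<^sub>R x)" using le[of "inverse c" "c *\<^sub>R x"] assms by simp
  then have "c * nN t x \<le> nN t (c *\<^sub>R x)" using assms by (simp add: field_simps)
  then show ?thesis using le[OF assms, of x] by simp
qed

lemma nS_scale: assumes "0 < c" shows "nS t (c *\<^sub>R x) = c * nS t x"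
proof -
  have le: "nS t (c *\<^sub>R x) \<le> c * nS t x" if "0 < c" for c x
  proof (rule nS_least)
    fix r assume r: "t \<le> r"
    have "L r t (c *\<^sub>R x - Q t (c *\<^sub>R x)) = c *\<^sub>R L r t (x - Q t x)"
      by (simp add: blinfun.scaleR_right flip: scaleR_diff_right)
    then have "exp (\<gamma> * (r - t)) * norm (L r t (c *\<^sub>R x - Q t (c *\<^sub>R x))) = c * (exp (\<gamma> * (r - t)) * norm (L r t (x - Q t x)))"
      using that by simp
    also have "\<dots> \<le> c * nS t x" using that r by (intro mult_left_mono nS_upper) auto
    finally show "exp (\<gamma> * (r - t)) * norm (L r t (c *\<^sub>R x - Q t (c *\<^sub>R x))) \<le> c * nS t x" .
  qed
  have "nS t x \<le> inverse c * nS t (c *\<^sub>R x)" using le[of "inverse c" "c *\<^sub>R x"] assms by simp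
  then have "c * nS t x \<le> nS t (c *\<^sub>R x)" using assms by (simp add: field_simps)
  then show ?thesis using le[OF assms, of x] by simp
qed

text \<open>Each term under the supremum is the norm of a bounded linear image, which commutes with
  the integral. The majorant \<open>h\<close> stands in for \<open>nN t (g s)\<close>, whose
  integrability in \<open>s\<close> is not clear.\<close>

lemma nN_integral:
  fixes g :: "real \<Rightarrow> 'a"
  assumes g: "g integrable_on {a..b}" and h: "h integrable_on {a..b}"
    and le: "\<And>s. s \<in> {a..b} \<Longrightarrow> nN t (g s) \<le> h s"
  shows "nN t (integral {a..b} g) \<le> integral {a..b} h"
proof (rule nN_least)
  fix r assume r: "r \<le> t"
  let ?e = "exp (\<rho> * (r - t))"
  have bl: "bounded_linear (\<lambda>x. ?e *\<^sub>R B r t x)"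
    by (intro bounded_linear_scaleR_right bounded_linear_compose[OF bounded_linear_scaleR_right] bounded_linear_B r)
  have "?e * norm (B r t (integral {a..b} g)) = norm (?e *\<^sub>R B r t (integral {a..b} g))" by simp
  also have "\<dots> = norm (integral {a..b} (\<lambda>s. ?e *\<^sub>R B r t (g s)))"
    using integral_linear[OF g bl] by (simp only: o_def)
  also have "\<dots> \<le> integral {a..b} h"
  proof (rule integral_norm_bound_integral[OF _ h])
    show "(\<lambda>s. ?e *\<^sub>R B r t (g s)) integrable_on {a..b}"
      using integrable_linear[OF g bl] by (simp only: o_def)
    fix s assume "s \<in> {a..b}"
    then show "norm (?e *\<^sub>R B r t (g s)) \<le> h s"
      using nN_upper[OF r, of "g s"] le[of s] by simp
  qed
  finally show "?e * norm (B r t (integral {a..b} g)) \<le> integral {a..b} h" .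
qed

lemma nS_integral:
  fixes g :: "real \<Rightarrow> 'a"
  assumes g: "g integrable_on {a..b}" and h: "h integrable_on {a..b}"
    and le: "\<And>s. s \<in> {a..b} \<Longrightarrow> nS t (g s) \<le> h s"
  shows "nS t (integral {a..b} g) \<le> integral {a..b} h"
proof (rule nS_least)
  fix r assume r: "t \<le> r"
  let ?F = "exp (\<gamma> * (r - t)) *\<^sub>R (L r t o\<^sub>L (id_blinfun - Q t))"
  have F: "?F x = exp (\<gamma> * (r - t)) *\<^sub>R L r t (x - Q t x)" for x
    by (simp add: minus_blinfun.rep_eq scaleR_blinfun.rep_eq)
  have bl: "bounded_linear (blinfun_apply ?F)" by (rule blinfun.bounded_linear_right)
  have "exp (\<gamma> * (r - t)) * norm (L r t (integral {a..b} g - Q t (integral {a..b} g))) = norm (?F (integral {a..b} g))"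
    unfolding F by simp
  also have "\<dots> = norm (integral {a..b} (\<lambda>s. ?F (g s)))"
    using integral_linear[OF g bl] by (simp only: o_def)
  also have "\<dots> \<le> integral {a..b} h"
  proof (rule integral_norm_bound_integral[OF _ h])
    show "(\<lambda>s. ?F (g s)) integrable_on {a..b}"
      using integrable_linear[OF g bl] by (simp only: o_def)
    fix s assume "s \<in> {a..b}"
    then show "norm (?F (g s)) \<le> h s"
      unfolding F using nS_upper[OF r, of "g s"] le[of s] by simp
  qed
  finally show "exp (\<gamma> * (r - t)) * norm (L r t (integral {a..b} g - Q t (integral {a..b} g))) \<le> integral {a..b} h" .
qed

end

section \<open>Variation of constants\<close>

lemma has_integral_exp_decay:
  fixes a b k :: real
  assumes "a \<le> b" "k \<noteq> 0"
  shows "((\<lambda>s. exp (- k * (s - a))) has_integral (1 - exp (- k * (b - a))) / k) {a..b}"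
proof -
  have "((\<lambda>s. exp (- k * (s - a))) has_integral (- exp (- k * (b - a)) / k - (- exp (- k * (a - a)) / k))) {a..b}"
    using assms
    by (intro fundamental_theorem_of_calculus)
      (auto intro!: derivative_eq_intros simp flip: has_real_derivative_iff_has_vector_derivative)
  then show ?thesis by (simp add: diff_divide_distrib)
qed

text \<open>The rate \<open>c\<close> may be negative: \<open>nS_voc\<close> and
  \<open>voc_zero_unique\<close> apply it to growing exponentials.\<close>

lemma has_integral_scaled_exp:
  fixes a b c :: real
  assumes "a \<le> b" "c \<noteq> 0" and eq: "\<And>s. h s = C * exp (- c * (s - a))"
  shows "(h has_integral C * ((1 - exp (- c * (b - a))) / c)) {a..b}"
proof -
  have "h = (\<lambda>s. C * exp (- c * (s - a)))" using eq by blast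
  then show ?thesis
    using has_integral_mult_right[OF has_integral_exp_decay[OF assms(1,2)], of C] by simp
qed

context splitting
begin

text \<open>No uniform boundedness principle is needed: on \<open>Q(s)X\<close> the operator \<open>L(t, s)\<close> factors as
  \<open>B(t, b) L(b, \<tau>) B(\<tau>, s)\<close> through one fixed operator and two backward flows.\<close>

lemma L_locally_bounded:
  assumes "\<tau> \<le> b"
  obtains K where "K > 0" "\<And>s t x. \<tau> \<le> s \<Longrightarrow> s \<le> t \<Longrightarrow> t \<le> b \<Longrightarrow> norm (L t s x) \<le> K * norm x"
proof -
  define E where "E = M * exp (\<bar>\<rho>\<bar> * (b - \<tau>))"
  define G where "G = M * exp (\<bar>\<gamma>\<bar> * (b - \<tau>))"
  have EG: "E > 0" "G > 0" using M_ge_1 by (auto simp: E_def G_def)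
  have ex: "exp (c * u) \<le> exp (\<bar>c\<bar> * (b - \<tau>))" if "0 \<le> u" "u \<le> b - \<tau>" for c u :: real
  proof -
    have "c * u \<le> \<bar>c\<bar> * u" using that by (intro mult_right_mono) auto
    also have "\<dots> \<le> \<bar>c\<bar> * (b - \<tau>)" using that by (intro mult_left_mono) auto
    finally show ?thesis by simp
  qed
  have bB: "norm (B t s x) \<le> E * norm x" if "\<tau> \<le> t" "t \<le> s" "s \<le> b" for t s x
  proof -
    have "norm (B t s x) \<le> M * exp (\<rho> * (s - t)) * norm x" using that by (intro B_bound') auto
    also have "\<dots> \<le> E * norm x"
      unfolding E_def using M_ge_1 that by (intro mult_right_mono mult_left_mono ex) auto
    finally show ?thesis .
  qed
  have "norm (L t s x) \<le> (E * (norm (L b \<tau>) * E) + G) * norm x" if t: "\<tau> \<le> s" "s \<le> t" "t \<le> b" for s t x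
  proof -
    have "L b \<tau> (B \<tau> s x) = L b s (Q s x)"
      using t L_comp[of \<tau> s b "B \<tau> s x"] L_B[of \<tau> s x] by simp
    then have eq: "L t s x = B t b (L b \<tau> (B \<tau> s x)) + L t s (x - Q s x)"
      using t by (simp add: B_L_forward blinfun.diff_right)
    have "norm (B t b (L b \<tau> (B \<tau> s x))) \<le> E * norm (L b \<tau> (B \<tau> s x))"
      using t by (intro bB) auto
    also have "\<dots> \<le> E * (norm (L b \<tau>) * norm (B \<tau> s x))"
      using EG by (intro mult_left_mono norm_blinfun) auto
    also have "\<dots> \<le> E * (norm (L b \<tau>) * (E * norm x))"
      using EG t by (intro mult_left_mono bB) auto
    finally have 1: "norm (B t b (L b \<tau> (B \<tau> s x))) \<le> E * (norm (L b \<tau>) * E) * norm x" by (simp add: mult.assoc)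
    have "norm (L t s (x - Q s x)) \<le> M * exp (- \<gamma> * (t - s)) * norm x" using t by (intro L_stable') auto
    also have "\<dots> \<le> G * norm x"
      unfolding G_def using M_ge_1 t ex[of "t - s" "- \<gamma>"] by (intro mult_right_mono mult_left_mono) auto
    finally have 2: "norm (L t s (x - Q s x)) \<le> G * norm x" .
    show ?thesis unfolding eq using 1 2 norm_triangle_ineq[of "B t b (L b \<tau> (B \<tau> s x))" "L t s (x - Q s x)"]
      by (simp add: distrib_right)
  qed
  moreover have "E * (norm (L b \<tau>) * E) + G > 0" using EG by (intro add_nonneg_pos mult_nonneg_nonneg) auto
  ultimately show ?thesis using that by blast
qed

text \<open>\<open>L\<close> is only strongly continuous. Near a point where \<open>g\<close> has
  the value \<open>x\<close>, the part \<open>L t s (g s - x)\<close> is controlled by the locally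
  uniform bound and \<open>L t s x\<close> by strong continuity.\<close>

lemma L_apply_continuous:
  assumes g: "continuous_on {\<tau>..b} g" and "\<tau> \<le> b"
  shows "continuous_on {(t, s). \<tau> \<le> s \<and> s \<le> t \<and> t \<le> b} (\<lambda>(t, s). L t s (g s))"
proof -
  let ?D = "{(t, s). \<tau> \<le> s \<and> s \<le> t \<and> t \<le> b}"
  obtain K where K: "K > 0" "\<And>s t x. \<tau> \<le> s \<Longrightarrow> s \<le> t \<Longrightarrow> t \<le> b \<Longrightarrow> norm (L t s x) \<le> K * norm x"
    using L_locally_bounded[OF assms(2)] by blast
  have gc: "continuous_on ?D (\<lambda>p. g (snd p))"
    by (rule continuous_on_compose2[OF g]) (auto intro: continuous_intros)
  show ?thesis
    unfolding continuous_on_def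
  proof
    fix p0 assume p0: "p0 \<in> ?D"
    let ?x = "g (snd p0)"
    have "((\<lambda>p. K * norm (g (snd p) - ?x)) \<longlongrightarrow> K * norm (?x - ?x)) (at p0 within ?D)"
      using gc p0 unfolding continuous_on_def by (intro tendsto_intros) blast
    then have "((\<lambda>p. K * norm (g (snd p) - ?x)) \<longlongrightarrow> 0) (at p0 within ?D)" by simp
    then have 1: "((\<lambda>p. L (fst p) (snd p) (g (snd p) - ?x)) \<longlongrightarrow> 0) (at p0 within ?D)"
      by (rule Lim_null_comparison[rotated]) (auto simp: eventually_at_filter intro!: always_eventually K)
    have "continuous_on ?D (\<lambda>(t, s). L t s ?x)"
      by (rule continuous_on_subset[OF L_cont]) auto
    then have 2: "((\<lambda>p. L (fst p) (snd p) ?x) \<longlongrightarrow> L (fst p0) (snd p0) ?x) (at p0 within ?D)"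
      using p0 unfolding continuous_on_def by (cases p0) (auto simp: case_prod_beta')
    show "((\<lambda>(t, s). L t s (g s)) \<longlongrightarrow> (case p0 of (t, s) \<Rightarrow> L t s (g s))) (at p0 within ?D)"
      using tendsto_add[OF 1 2] by (simp add: case_prod_beta' blinfun.diff_right)
  qed
qed

text \<open>Variation of constants: \<open>w\<close> is the mild solution on \<open>[\<tau>, \<infinity>)\<close> of \<open>w' = A(t) w + g(t)\<close>.\<close>

definition voc :: "real \<Rightarrow> (real \<Rightarrow> 'a) \<Rightarrow> (real \<Rightarrow> 'a) \<Rightarrow> bool" where
  "voc \<tau> w g \<longleftrightarrow> continuous_on {\<tau>..} g \<and>
     (\<forall>t\<ge>\<tau>. w t = L t \<tau> (w \<tau>) + integral {\<tau>..t} (\<lambda>s. L t s (g s)))"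

lemma voc_input_continuous: "voc \<tau> w g \<Longrightarrow> continuous_on {\<tau>..} g"
  unfolding voc_def by blast

lemma voc_formula:
  "voc \<tau> w g \<Longrightarrow> \<tau> \<le> t \<Longrightarrow> w t = L t \<tau> (w \<tau>) + integral {\<tau>..t} (\<lambda>s. L t s (g s))"
  unfolding voc_def by blast

lemma L_apply_integrable:
  assumes g: "continuous_on {\<tau>..} g" and "\<tau> \<le> a" "b \<le> t"
  shows "(\<lambda>s. L t s (g s)) integrable_on {a..b}"
proof (cases "a \<le> b")
  case True
  have "continuous_on {\<tau>..t} g" by (rule continuous_on_subset[OF g]) auto
  then have "continuous_on {(t', s). \<tau> \<le> s \<and> s \<le> t' \<and> t' \<le> t} (\<lambda>(t, s). L t s (g s))"
    by (rule L_apply_continuous) (use assms True in auto)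
  then have "continuous_on {a..b} (\<lambda>s. case (t, s) of (t, s) \<Rightarrow> L t s (g s))"
    by (rule continuous_on_compose2) (use assms True in \<open>auto intro!: continuous_intros\<close>)
  then show ?thesis by (intro integrable_continuous_interval) simp
qed (simp add: integrable_on_empty)

text \<open>By \<open>B_L\<close>, \<open>B t s\<close> is the fixed bounded operator
  \<open>B t b\<close> after \<open>L b s\<close>, so integrability is inherited from the forward
  flow.\<close>

lemma B_apply_integrable:
  assumes g: "continuous_on {\<tau>..} g" and "\<tau> \<le> a" "t \<le> a"
  shows "(\<lambda>s. B t s (g s)) integrable_on {a..b}"
proof (cases "a \<le> b")
  case True
  have "(B t b \<circ> (\<lambda>s. L b s (g s))) integrable_on {a..b}"
    using assms True by (intro integrable_linear L_apply_integrable[OF g] bounded_linear_B) auto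
  then show ?thesis
    by (rule integrable_eq) (use assms in \<open>simp add: B_L\<close>)
qed (simp add: integrable_on_empty)

lemma L_integral:
  assumes g: "continuous_on {\<tau>..} g" and "\<tau> \<le> a" "b \<le> s" "s \<le> t"
  shows "L t s (integral {a..b} (\<lambda>r. L s r (g r))) = integral {a..b} (\<lambda>r. L t r (g r))"
proof -
  have "L t s (integral {a..b} (\<lambda>r. L s r (g r))) = integral {a..b} (blinfun_apply (L t s) \<circ> (\<lambda>r. L s r (g r)))"
    by (rule integral_linear[symmetric]) (use assms in \<open>auto intro!: L_apply_integrable[OF g] blinfun.bounded_linear_right\<close>)
  also have "\<dots> = integral {a..b} (\<lambda>r. L t r (g r))"
    by (rule integral_cong) (use assms in \<open>auto simp: L_comp\<close>)
  finally show ?thesis .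
qed

lemma voc_shift:
  assumes "voc \<tau> w g" "\<tau> \<le> s" "s \<le> t"
  shows "w t = L t s (w s) + integral {s..t} (\<lambda>r. L t r (g r))"
proof -
  have g: "continuous_on {\<tau>..} g" using assms voc_input_continuous by blast
  have "w s = L s \<tau> (w \<tau>) + integral {\<tau>..s} (\<lambda>r. L s r (g r))"
    by (rule voc_formula) (use assms in auto)
  then have "L t s (w s) = L t \<tau> (w \<tau>) + integral {\<tau>..s} (\<lambda>r. L t r (g r))"
    using assms by (simp add: blinfun.add_right L_comp L_integral[OF g])
  moreover have "integral {\<tau>..s} (\<lambda>r. L t r (g r)) + integral {s..t} (\<lambda>r. L t r (g r))
      = integral {\<tau>..t} (\<lambda>r. L t r (g r))"
    using assms by (intro Henstock_Kurzweil_Integration.integral_combine L_apply_integrable[OF g]) auto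
  moreover have "w t = L t \<tau> (w \<tau>) + integral {\<tau>..t} (\<lambda>r. L t r (g r))"
    by (rule voc_formula) (use assms in auto)
  ultimately show ?thesis by (simp add: algebra_simps)
qed

text \<open>The Lyapunov--Perron formula with finite horizon \<open>b\<close>: solved for
  \<open>Q t (w t)\<close>, it expresses the unstable component by the future of \<open>g\<close>
  and a boundary term at \<open>b\<close>.\<close>

lemma B_voc:
  assumes "voc \<tau> w g" "\<tau> \<le> t" "t \<le> b"
  shows "B t b (w b) = Q t (w t) + integral {t..b} (\<lambda>s. B t s (g s))"
proof -
  have g: "continuous_on {\<tau>..} g" using assms voc_input_continuous by blast
  have "B t b (w b) = B t b (L b t (w t)) + B t b (integral {t..b} (\<lambda>r. L b r (g r)))"
    using voc_shift[OF assms] linear_add[OF linear_B[OF assms(3)]] by metis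
  also have "B t b (L b t (w t)) = Q t (w t)" using assms by (simp add: B_L B_refl)
  also have "B t b (integral {t..b} (\<lambda>r. L b r (g r))) = integral {t..b} (B t b \<circ> (\<lambda>r. L b r (g r)))"
    by (rule integral_linear[symmetric]) (use assms in \<open>auto intro!: L_apply_integrable[OF g] bounded_linear_B\<close>)
  also have "\<dots> = integral {t..b} (\<lambda>s. B t s (g s))"
    by (rule integral_cong) (use assms in \<open>auto simp: B_L\<close>)
  finally show ?thesis .
qed

text \<open>Here \<open>t\<close> occurs in the integrand and in the range of integration. Replacing
  \<open>L t s\<close> by \<open>L (max t s) s\<close> fixes the range to
  \<open>[\<tau>, b]\<close>; the surplus over \<open>[t, b]\<close> is the integral of
  \<open>g\<close>, as \<open>L s s\<close> is the identity.\<close>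

lemma voc_continuous:
  assumes "voc \<tau> w g" shows "continuous_on {\<tau>..} w"
proof -
  have g: "continuous_on {\<tau>..} g" using assms voc_input_continuous by blast
  have "continuous_on {\<tau>..b} w" if "\<tau> \<le> b" for b
  proof -
    have gb: "continuous_on {\<tau>..b} g" by (rule continuous_on_subset[OF g]) auto
    have D: "continuous_on {(t, s). \<tau> \<le> s \<and> s \<le> t \<and> t \<le> b} (\<lambda>(t, s). L t s (g s))"
      by (rule L_apply_continuous[OF gb that])
    have "continuous_on ({\<tau>..b} \<times> cbox \<tau> b) (\<lambda>p. (\<lambda>(t, s). L t s (g s)) (max (fst p) (snd p), snd p))"
      by (rule continuous_on_compose2[OF D]) (auto intro!: continuous_intros)
    then have 1: "continuous_on {\<tau>..b} (\<lambda>t. integral (cbox \<tau> b) (\<lambda>s. L (max t s) s (g s)))"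
      by (intro integral_continuous_on_param) (simp add: case_prod_beta')
    have 2: "continuous_on {\<tau>..b} (\<lambda>t. integral {t..b} g)"
      by (intro indefinite_integral_continuous_1' integrable_continuous_interval gb)
    have 3: "continuous_on {\<tau>..b} (\<lambda>t. L t \<tau> (w \<tau>))"
      by (rule continuous_on_compose2[OF L_cont, of "{\<tau>..b}" "\<lambda>t. (t, \<tau>)", simplified])
        (auto intro!: continuous_intros)
    have "w t = L t \<tau> (w \<tau>) + (integral (cbox \<tau> b) (\<lambda>s. L (max t s) s (g s)) - integral {t..b} g)"
      if t: "t \<in> {\<tau>..b}" for t
    proof -
      have "continuous_on {\<tau>..b} (\<lambda>s. (\<lambda>(t, s). L t s (g s)) (max t s, s))"
        by (rule continuous_on_compose2[OF D]) (use t in \<open>auto intro!: continuous_intros\<close>)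
      then have "(\<lambda>s. L (max t s) s (g s)) integrable_on {\<tau>..b}"
        by (intro integrable_continuous_interval) simp
      then have "integral {\<tau>..t} (\<lambda>s. L (max t s) s (g s)) + integral {t..b} (\<lambda>s. L (max t s) s (g s))
          = integral {\<tau>..b} (\<lambda>s. L (max t s) s (g s))"
        using t by (intro Henstock_Kurzweil_Integration.integral_combine) auto
      moreover have "integral {\<tau>..t} (\<lambda>s. L (max t s) s (g s)) = integral {\<tau>..t} (\<lambda>s. L t s (g s))"
        by (rule integral_cong) auto
      moreover have "integral {t..b} (\<lambda>s. L (max t s) s (g s)) = integral {t..b} g"
        by (rule integral_cong) auto
      moreover have "w t = L t \<tau> (w \<tau>) + integral {\<tau>..t} (\<lambda>s. L t s (g s))"
        using t by (intro voc_formula[OF assms]) auto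
      ultimately show ?thesis by (simp add: algebra_simps)
    qed
    then show ?thesis
      by (intro continuous_on_eq[OF continuous_on_add[OF 3 continuous_on_diff[OF 1 2]]]) (rule sym)
  qed
  note c = this
  show ?thesis
    unfolding continuous_on_eq_continuous_within
  proof
    fix t assume t: "t \<in> {\<tau>..}"
    then have "continuous (at t within {\<tau>..t+1}) w"
      by (intro bspec[OF c[of "t+1", unfolded continuous_on_eq_continuous_within]]) auto
    moreover have "at t within {\<tau>..t+1} = at t within {\<tau>..}"
      by (rule at_within_nhd[of t "{..<t+1}"]) auto
    ultimately show "continuous (at t within {\<tau>..}) w" by simp
  qed
qed

text \<open>In \<open>B_voc\<close> let \<open>b = \<tau> + n\<close> tend to infinity:
  \<open>lim\<close> removes the boundary term, and the integrals stay bounded because both rates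
  exceed \<rho>. Two rates are carried because \<open>comparison\<close> estimates a profile and an
  excess over it together.\<close>

lemma nN_voc:
  assumes w: "voc \<tau> w g" and t: "\<tau> \<le> t"
    and lim: "(\<lambda>n. B t (\<tau> + real n) (w (\<tau> + real n))) \<longlonglongrightarrow> 0"
    and g: "\<And>s. \<tau> \<le> s \<Longrightarrow> nN s (g s) \<le> C * exp (- \<alpha> * (s - \<tau>)) + D * exp (- \<beta> * (s - \<tau>))"
    and "\<rho> < \<alpha>" "\<rho> < \<beta>" "0 \<le> C" "0 \<le> D"
  shows "nN t (w t) \<le> C / (\<alpha> - \<rho>) * exp (- \<alpha> * (t - \<tau>)) + D / (\<beta> - \<rho>) * exp (- \<beta> * (t - \<tau>))" (is "_ \<le> ?R")
proof -
  have gc: "continuous_on {\<tau>..} g" using w voc_input_continuous by blast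
  have le: "nN t (w t) \<le> M * norm (B t (\<tau> + real n) (w (\<tau> + real n))) + ?R" if n: "t \<le> \<tau> + real n" for n
  proof -
    define b where "b = \<tau> + real n"
    have b: "t \<le> b" using n by (simp add: b_def)
    define h where "h = (\<lambda>E \<epsilon> s. exp (\<rho> * (s - t)) * (E * exp (- \<epsilon> * (s - \<tau>))) :: real)"
    have h: "(h E \<epsilon> has_integral (E * exp (- \<epsilon> * (t - \<tau>))) * ((1 - exp (- (\<epsilon> - \<rho>) * (b - t))) / (\<epsilon> - \<rho>))) {t..b}"
      if "\<rho> < \<epsilon>" for E \<epsilon>
      by (rule has_integral_scaled_exp)
        (use b that in \<open>auto simp: h_def algebra_simps simp flip: exp_add\<close>)
    have hle: "integral {t..b} (h E \<epsilon>) \<le> E / (\<epsilon> - \<rho>) * exp (- \<epsilon> * (t - \<tau>))" if "\<rho> < \<epsilon>" "0 \<le> E" for E \<epsilon>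
    proof -
      have "(E * exp (- \<epsilon> * (t - \<tau>))) * ((1 - exp (- (\<epsilon> - \<rho>) * (b - t))) / (\<epsilon> - \<rho>)) \<le> (E * exp (- \<epsilon> * (t - \<tau>))) * (1 / (\<epsilon> - \<rho>))"
        using that by (intro mult_left_mono divide_right_mono) auto
      then show ?thesis using integral_unique[OF h[OF that(1)]] by simp
    qed
    have hi: "h C \<alpha> integrable_on {t..b}" "h D \<beta> integrable_on {t..b}"
      using h assms by blast+
    have "nN t (integral {t..b} (\<lambda>s. B t s (g s))) \<le> integral {t..b} (\<lambda>s. h C \<alpha> s + h D \<beta> s)"
    proof (rule nN_integral)
      show "(\<lambda>s. B t s (g s)) integrable_on {t..b}"
        by (rule B_apply_integrable[OF gc]) (use t in auto)
      show "(\<lambda>s. h C \<alpha> s + h D \<beta> s) integrable_on {t..b}" by (intro integrable_add hi)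
      fix s assume s: "s \<in> {t..b}"
      have "nN t (B t s (g s)) \<le> exp (\<rho> * (s - t)) * nN s (g s)" using s by (intro nN_B) auto
      also have "\<dots> \<le> exp (\<rho> * (s - t)) * (C * exp (- \<alpha> * (s - \<tau>)) + D * exp (- \<beta> * (s - \<tau>)))"
        using s t by (intro mult_left_mono g) auto
      finally show "nN t (B t s (g s)) \<le> h C \<alpha> s + h D \<beta> s" by (simp add: h_def distrib_left)
    qed
    also have "\<dots> = integral {t..b} (h C \<alpha>) + integral {t..b} (h D \<beta>)"
      by (rule integral_add[OF hi])
    also have "\<dots> \<le> ?R" using assms by (intro add_mono hle) auto
    finally have 1: "nN t (integral {t..b} (\<lambda>s. B t s (g s))) \<le> ?R" .
    have "Q t (w t) = B t b (w b) + - integral {t..b} (\<lambda>s. B t s (g s))"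
      using B_voc[OF w t b] by simp
    then have "nN t (w t) \<le> nN t (B t b (w b)) + nN t (integral {t..b} (\<lambda>s. B t s (g s)))"
      using nN_add nN_minus nN_Q by metis
    then show ?thesis using 1 nN_le_norm[of t "B t b (w b)"] unfolding b_def by linarith
  qed
  have "(\<lambda>n. M * norm (B t (\<tau> + real n) (w (\<tau> + real n))) + ?R) \<longlonglongrightarrow> M * norm (0::'a) + ?R"
    by (intro tendsto_intros lim)
  then have "(\<lambda>n. M * norm (B t (\<tau> + real n) (w (\<tau> + real n))) + ?R) \<longlonglongrightarrow> ?R" by simp
  then show ?thesis
  proof (rule LIMSEQ_le_const)
    obtain N :: nat where "t - \<tau> \<le> real N" using real_arch_simple by blast
    then show "\<exists>N. \<forall>n\<ge>N. nN t (w t) \<le> M * norm (B t (\<tau> + real n) (w (\<tau> + real n))) + ?R"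
      by (intro exI[of _ N] allI impI le) linarith
  qed
qed

text \<open>The term with rate \<alpha> keeps its negative part: in \<open>comparison\<close> it
  cancels the contribution of the initial value exactly. For the rate \<beta> the cruder bound
  suffices.\<close>

lemma nS_voc:
  assumes w: "voc \<tau> w g" and t: "\<tau> \<le> t"
    and g: "\<And>s. \<tau> \<le> s \<Longrightarrow> nS s (g s) \<le> C * exp (- \<alpha> * (s - \<tau>)) + D * exp (- \<beta> * (s - \<tau>))"
    and "\<alpha> < \<gamma>" "\<beta> < \<gamma>" "0 \<le> D"
  shows "nS t (w t) \<le> exp (- \<gamma> * (t - \<tau>)) * nS \<tau> (w \<tau>)
    + C / (\<gamma> - \<alpha>) * (exp (- \<alpha> * (t - \<tau>)) - exp (- \<gamma> * (t - \<tau>))) + D / (\<gamma> - \<beta>) * exp (- \<beta> * (t - \<tau>))"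
proof -
  have gc: "continuous_on {\<tau>..} g" using w voc_input_continuous by blast
  define h where "h = (\<lambda>E \<epsilon> s. exp (- \<gamma> * (t - s)) * (E * exp (- \<epsilon> * (s - \<tau>))) :: real)"
  have h: "(h E \<epsilon> has_integral E / (\<gamma> - \<epsilon>) * (exp (- \<epsilon> * (t - \<tau>)) - exp (- \<gamma> * (t - \<tau>)))) {\<tau>..t}"
    if "\<epsilon> < \<gamma>" for E \<epsilon>
  proof -
    have *: "(h E \<epsilon> has_integral (E * exp (- \<gamma> * (t - \<tau>))) * ((1 - exp (- (\<epsilon> - \<gamma>) * (t - \<tau>))) / (\<epsilon> - \<gamma>))) {\<tau>..t}"
      by (rule has_integral_scaled_exp)
        (use t that in \<open>auto simp: h_def algebra_simps simp flip: exp_add\<close>)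
    have "exp (- \<gamma> * (t - \<tau>)) * exp (- (\<epsilon> - \<gamma>) * (t - \<tau>)) = exp (- \<epsilon> * (t - \<tau>))"
      by (simp add: algebra_simps flip: exp_add)
    moreover have "(E * x) * ((1 - y) / (\<epsilon> - \<gamma>)) = E / (\<gamma> - \<epsilon>) * (x * y - x)" for x y
      using that by (simp add: field_simps)
    ultimately show ?thesis using * by simp
  qed
  have hi: "h C \<alpha> integrable_on {\<tau>..t}" "h D \<beta> integrable_on {\<tau>..t}"
    using h assms by blast+
  have "nS t (integral {\<tau>..t} (\<lambda>s. L t s (g s))) \<le> integral {\<tau>..t} (\<lambda>s. h C \<alpha> s + h D \<beta> s)"
  proof (rule nS_integral)
    show "(\<lambda>s. L t s (g s)) integrable_on {\<tau>..t}"
      by (rule L_apply_integrable[OF gc]) auto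
    show "(\<lambda>s. h C \<alpha> s + h D \<beta> s) integrable_on {\<tau>..t}" by (intro integrable_add hi)
    fix s assume s: "s \<in> {\<tau>..t}"
    have "nS t (L t s (g s)) \<le> exp (- \<gamma> * (t - s)) * nS s (g s)" using s by (intro nS_L) auto
    also have "\<dots> \<le> exp (- \<gamma> * (t - s)) * (C * exp (- \<alpha> * (s - \<tau>)) + D * exp (- \<beta> * (s - \<tau>)))"
      using s by (intro mult_left_mono g) auto
    finally show "nS t (L t s (g s)) \<le> h C \<alpha> s + h D \<beta> s" by (simp add: h_def distrib_left)
  qed
  also have "\<dots> = integral {\<tau>..t} (h C \<alpha>) + integral {\<tau>..t} (h D \<beta>)"
    by (rule integral_add[OF hi])
  also have "integral {\<tau>..t} (h D \<beta>) \<le> D / (\<gamma> - \<beta>) * exp (- \<beta> * (t - \<tau>))"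
    unfolding integral_unique[OF h[OF assms(5)]] using assms by (intro mult_left_mono) auto
  also have "integral {\<tau>..t} (h C \<alpha>) = C / (\<gamma> - \<alpha>) * (exp (- \<alpha> * (t - \<tau>)) - exp (- \<gamma> * (t - \<tau>)))"
    by (rule integral_unique[OF h[OF assms(4)]])
  finally have "nS t (integral {\<tau>..t} (\<lambda>s. L t s (g s))) \<le>
    C / (\<gamma> - \<alpha>) * (exp (- \<alpha> * (t - \<tau>)) - exp (- \<gamma> * (t - \<tau>))) + D / (\<gamma> - \<beta>) * exp (- \<beta> * (t - \<tau>))"
    by simp
  moreover have "nS t (w t) \<le> nS t (L t \<tau> (w \<tau>)) + nS t (integral {\<tau>..t} (\<lambda>s. L t s (g s)))"
    by (subst voc_formula[OF w t]) (rule nS_add)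
  ultimately show ?thesis using nS_L[OF t, of "w \<tau>"] by linarith
qed

lemma voc_diff:
  assumes "voc \<tau> w g" "voc \<tau> w' g'"
  shows "voc \<tau> (\<lambda>t. w t - w' t) (\<lambda>t. g t - g' t)"
  unfolding voc_def
proof (intro conjI allI impI)
  have g: "continuous_on {\<tau>..} g" "continuous_on {\<tau>..} g'" using assms voc_input_continuous by blast+
  then show "continuous_on {\<tau>..} (\<lambda>t. g t - g' t)" by (intro continuous_intros)
  fix t assume t: "\<tau> \<le> t"
  have "integral {\<tau>..t} (\<lambda>s. L t s (g s) - L t s (g' s)) =
    integral {\<tau>..t} (\<lambda>s. L t s (g s)) - integral {\<tau>..t} (\<lambda>s. L t s (g' s))"
    by (intro integral_diff L_apply_integrable[OF g(1)] L_apply_integrable[OF g(2)]) auto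
  moreover have "w t = L t \<tau> (w \<tau>) + integral {\<tau>..t} (\<lambda>s. L t s (g s))"
    "w' t = L t \<tau> (w' \<tau>) + integral {\<tau>..t} (\<lambda>s. L t s (g' s))" using assms t voc_formula by blast+
  ultimately show "w t - w' t = L t \<tau> (w \<tau> - w' \<tau>) + integral {\<tau>..t} (\<lambda>s. L t s (g s - g' s))"
    by (simp add: blinfun.diff_right)
qed

text \<open>Gronwall by an exponential weight: with weight
  \<open>exp (- (2*c) * (t - \<tau>))\<close> the integral at a maximum point \<open>t0\<close> of
  \<open>v\<close> costs a factor 1/2, so the maximum satisfies
  \<open>m \<le> m / 2\<close>.\<close>

lemma voc_zero_unique:
  assumes w: "voc \<tau> w g" and w0: "w \<tau> = 0" and K: "\<And>s. \<tau> \<le> s \<Longrightarrow> norm (g s) \<le> K * norm (w s)"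
    and "\<tau> \<le> b"
  shows "w b = 0"
proof -
  have gc: "continuous_on {\<tau>..} g" using w voc_input_continuous by blast
  obtain K' where K': "K' > 0" "\<And>s t x. \<tau> \<le> s \<Longrightarrow> s \<le> t \<Longrightarrow> t \<le> b \<Longrightarrow> norm (L t s x) \<le> K' * norm x"
    using L_locally_bounded[OF assms(4)] by blast
  \<comment> \<open>The summand 1 keeps the rate positive even for \<open>K = 0\<close>.\<close>
  define c where "c = K' * \<bar>K\<bar> + 1"
  have c: "c > 0" using K' by (simp add: c_def add_nonneg_pos)
  define v where "v = (\<lambda>t. exp (- (2*c) * (t - \<tau>)) * norm (w t))"
  have "continuous_on {\<tau>..b} v" unfolding v_def
    by (intro continuous_intros continuous_on_subset[OF voc_continuous[OF w]]) auto
  then obtain t0 where t0: "t0 \<in> {\<tau>..b}" "\<And>t. t \<in> {\<tau>..b} \<Longrightarrow> v t \<le> v t0"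
    using continuous_attains_sup[of "{\<tau>..b}" v] assms(4) by auto
  define m where "m = v t0"
  have m0: "0 \<le> m" by (simp add: m_def v_def)
  define h where "h = (\<lambda>s. c * (m * exp (2*c * (s - \<tau>))))"
  have hh: "(h has_integral (c*m) * ((1 - exp (- (-(2*c)) * (t0 - \<tau>))) / (-(2*c)))) {\<tau>..t0}"
    by (rule has_integral_scaled_exp) (use t0 c in \<open>auto simp: h_def\<close>)
  have "norm (w t0) = norm (integral {\<tau>..t0} (\<lambda>s. L t0 s (g s)))"
    by (subst voc_formula[OF w]) (use t0 in \<open>auto simp: w0\<close>)
  also have "\<dots> \<le> integral {\<tau>..t0} h"
  proof (rule integral_norm_bound_integral)
    show "(\<lambda>s. L t0 s (g s)) integrable_on {\<tau>..t0}" by (rule L_apply_integrable[OF gc]) auto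
    show "h integrable_on {\<tau>..t0}" using hh by blast
    fix s assume s: "s \<in> {\<tau>..t0}"
    have "norm (L t0 s (g s)) \<le> K' * norm (g s)" using s t0 by (intro K') auto
    also have "\<dots> \<le> K' * (\<bar>K\<bar> * norm (w s))"
      using s K[of s] K' by (intro mult_left_mono order_trans[OF K mult_right_mono]) auto
    also have "\<dots> \<le> c * norm (w s)" by (simp add: c_def distrib_right)
    also have "norm (w s) = exp (2*c * (s - \<tau>)) * v s" by (simp add: v_def flip: exp_add mult.assoc)
    also have "c * \<dots> \<le> h s"
      unfolding h_def m_def using c t0(2)[of s] s t0(1) by (auto simp: mult.commute intro!: mult_left_mono)
    finally show "norm (L t0 s (g s)) \<le> h s" by simp
  qed
  also have "\<dots> = m / 2 * (exp (2*c * (t0 - \<tau>)) - 1)"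
    unfolding integral_unique[OF hh] using c by (simp add: field_simps)
  also have "\<dots> \<le> m / 2 * exp (2*c * (t0 - \<tau>))" using m0 by (intro mult_left_mono) auto
  finally have "m \<le> exp (- (2*c) * (t0 - \<tau>)) * (m / 2 * exp (2*c * (t0 - \<tau>)))"
    unfolding m_def v_def by (intro mult_left_mono) auto
  also have "\<dots> = m / 2" by (simp flip: exp_add)
  finally have "m = 0" using m0 by simp
  then have "v b \<le> 0" using t0(2)[of b] assms(4) by (simp add: m_def)
  then show ?thesis by (simp add: v_def mult_le_0_iff)
qed

end

section \<open>Admissible norms and the comparison principle\<close>

locale admissible =
  fixes \<Gamma> :: "real \<times> real \<Rightarrow> real"
  assumes admissible: "admissible_norm \<Gamma>"
begin

lemma \<Gamma>_nonneg [simp]: "0 \<le> \<Gamma> p"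
  using admissible unfolding admissible_norm_def by blast

lemma \<Gamma>_add: "\<Gamma> (a + c, b + d) \<le> \<Gamma> (a, b) + \<Gamma> (c, d)"
  using admissible unfolding admissible_norm_def by (metis add_Pair)

lemma \<Gamma>_scale: "0 \<le> c \<Longrightarrow> \<Gamma> (c * a, c * b) = c * \<Gamma> (a, b)"
  using admissible unfolding admissible_norm_def
  by (metis abs_of_nonneg real_scaleR_def scaleR_Pair)

lemma \<Gamma>_pos: "a \<noteq> 0 \<or> b \<noteq> 0 \<Longrightarrow> 0 < \<Gamma> (a, b)"
  using admissible unfolding admissible_norm_def by (metis Pair_inject order_le_less zero_prod_def)

lemma \<Gamma>_mono:
  assumes "0 \<le> a" "a \<le> a'" "0 \<le> b" "b \<le> b'"
  shows "\<Gamma> (a, b) \<le> \<Gamma> (a', b')"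
proof -
  have "\<Gamma> (a, b) \<le> \<Gamma> (a', b)"
    using admissible assms unfolding admissible_norm_def mono_on_def by auto
  also have "\<dots> \<le> \<Gamma> (a', b')"
    using admissible assms unfolding admissible_norm_def mono_on_def by auto
  finally show ?thesis .
qed

lemma \<Gamma>_fst_le: "0 \<le> a \<Longrightarrow> 0 \<le> b \<Longrightarrow> a * \<Gamma> (1, 0) \<le> \<Gamma> (a, b)"
  using \<Gamma>_mono[of a a 0 b] \<Gamma>_scale[of a 1 0] by simp

lemma \<Gamma>_snd_le: "0 \<le> a \<Longrightarrow> 0 \<le> b \<Longrightarrow> b * \<Gamma> (0, 1) \<le> \<Gamma> (a, b)"
  using \<Gamma>_mono[of 0 a b b] \<Gamma>_scale[of b 0 1] by simp

lemma \<Gamma>_fst_Lipschitz: "\<Gamma> (a, b) - \<Gamma> (c, b) \<le> \<bar>a - c\<bar> * \<Gamma> (1, 0)"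
proof -
  have "\<Gamma> (a - c, 0) = \<bar>a - c\<bar> * \<Gamma> (1, 0)"
    using admissible unfolding admissible_norm_def
    by (metis mult.right_neutral mult_zero_right real_scaleR_def scaleR_Pair)
  then show ?thesis using \<Gamma>_add[of c "a - c" b 0] by simp
qed

lemma \<Gamma>_fst_continuous: "continuous_on S (\<lambda>a. \<Gamma> (a, b))"
proof -
  have "(\<Gamma> (1, 0))-lipschitz_on S (\<lambda>a. \<Gamma> (a, b))"
  proof (rule lipschitz_onI)
    fix x y
    show "dist (\<Gamma> (x, b)) (\<Gamma> (y, b)) \<le> \<Gamma> (1, 0) * dist x y"
      using \<Gamma>_fst_Lipschitz[of x b y] \<Gamma>_fst_Lipschitz[of y b x]
      by (simp add: dist_real_def abs_le_iff abs_minus_commute mult.commute)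
  qed simp
  then show ?thesis by (rule lipschitz_on_continuous_on)
qed

end

section \<open>The gap condition and the slope equation\<close>

locale spectral_gap = splitting L Q M \<gamma> \<rho> + admissible \<Gamma>
  for L :: "real \<Rightarrow> real \<Rightarrow> ('a::banach \<Rightarrow>\<^sub>L 'a)" and Q M \<gamma> \<rho> \<Gamma> +
  fixes L1 L2 \<sigma> :: real
  assumes L1: "0 < L1" and L2: "0 < L2"
    and rho_sigma: "\<rho> < \<sigma>" and sigma_gamma: "\<sigma> < \<gamma>"
    and gap: "\<Gamma> (L1 / (\<sigma> - \<rho>), L2 / (\<gamma> - \<sigma>)) < 1"
begin

text \<open>The upper bound for \<kappa> is the ratio of the two arguments of \<Gamma> in
  \<open>gap\<close>.\<close>

definition admissible_slope :: "real \<Rightarrow> bool" where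
  "admissible_slope \<kappa> \<longleftrightarrow> 0 < \<kappa> \<and> \<kappa> < L1 / L2 * ((\<gamma> - \<sigma>) / (\<sigma> - \<rho>)) \<and>
     \<gamma> - \<rho> = L1 * \<Gamma> (1, 1 / \<kappa>) + L2 * \<Gamma> (\<kappa>, 1)"

lemma \<Gamma>_inverse_slope: "0 < \<kappa> \<Longrightarrow> \<Gamma> (1, 1 / \<kappa>) = \<Gamma> (\<kappa>, 1) / \<kappa>"
  using \<Gamma>_scale[of "1 / \<kappa>" \<kappa> 1] by simp

text \<open>Up to the ratio of the arguments in \<open>gap\<close>, \<open>(\<kappa>, 1)\<close>
  lies componentwise below \<open>c = (\<gamma> - \<sigma>) / L2\<close> times that vector, whose
  \<Gamma>-norm is less than 1. This is what places the decay rate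
  \<open>\<gamma> - L2 * \<Gamma> (\<kappa>, 1)\<close> above \<sigma>.\<close>

lemma \<Gamma>_slope_lt:
  assumes "0 < \<kappa>" "\<kappa> \<le> L1 / L2 * ((\<gamma> - \<sigma>) / (\<sigma> - \<rho>))"
  shows "L2 * \<Gamma> (\<kappa>, 1) < \<gamma> - \<sigma>"
proof -
  define c where "c = (\<gamma> - \<sigma>) / L2"
  have c: "0 < c" using L2 sigma_gamma by (simp add: c_def)
  have "\<Gamma> (\<kappa>, 1) \<le> \<Gamma> (c * (L1 / (\<sigma> - \<rho>)), c * (L2 / (\<gamma> - \<sigma>)))"
    using assms L2 sigma_gamma by (intro \<Gamma>_mono) (auto simp: c_def algebra_simps)
  also have "\<dots> = c * \<Gamma> (L1 / (\<sigma> - \<rho>), L2 / (\<gamma> - \<sigma>))" using c by (intro \<Gamma>_scale) simp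
  also have "\<dots> < c" using c gap by simp
  finally show ?thesis using L2 by (simp add: c_def field_simps)
qed

lemma slope_exists: "\<exists>\<kappa>. admissible_slope \<kappa>"
proof -
  define \<kappa>0 where "\<kappa>0 = L1 / L2 * ((\<gamma> - \<sigma>) / (\<sigma> - \<rho>))"
  define h where "h \<kappa> = (L1 / \<kappa> + L2) * \<Gamma> (\<kappa>, 1)" for \<kappa>
  have k0: "0 < \<kappa>0" using L1 L2 rho_sigma sigma_gamma by (simp add: \<kappa>0_def)
  have h_eq: "h \<kappa> = L1 * \<Gamma> (1, 1 / \<kappa>) + L2 * \<Gamma> (\<kappa>, 1)" if "0 < \<kappa>" for \<kappa>
    using that by (simp add: h_def \<Gamma>_inverse_slope distrib_right)
  \<comment> \<open>The factor \<open>L1 / \<kappa>0 + L2\<close> equals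
    \<open>L2 * ((\<gamma> - \<rho>) / (\<gamma> - \<sigma>))\<close>. The strict inequality
    obtained here later excludes \<open>\<kappa> = \<kappa>0\<close>.\<close>
  have "h \<kappa>0 = (L2 * \<Gamma> (\<kappa>0, 1)) * ((\<gamma> - \<rho>) / (\<gamma> - \<sigma>))"
    using L1 L2 rho_sigma sigma_gamma by (simp add: h_def \<kappa>0_def field_simps)
  also have "\<dots> < (\<gamma> - \<sigma>) * ((\<gamma> - \<rho>) / (\<gamma> - \<sigma>))"
    using \<Gamma>_slope_lt[OF k0] rho_sigma sigma_gamma by (intro mult_strict_right_mono) (auto simp: \<kappa>0_def)
  also have "\<dots> = \<gamma> - \<rho>" using sigma_gamma by simp
  finally have top: "h \<kappa>0 < \<gamma> - \<rho>" .
  \<comment> \<open>Small enough that \<open>L1 * \<Gamma> (0, 1) / \<kappa>1\<close>, a lower bound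
    for \<open>h \<kappa>1\<close>, reaches \<open>\<gamma> - \<rho>\<close>; the minimum keeps
    \<open>\<kappa>1 \<le> \<kappa>0\<close>.\<close>
  define \<kappa>1 where "\<kappa>1 = min \<kappa>0 (L1 * \<Gamma> (0, 1) / (\<gamma> - \<rho>))"
  have g01: "0 < \<Gamma> (0, 1)" by (rule \<Gamma>_pos) simp
  have gr: "0 < \<gamma> - \<rho>" using rho_less_gamma by simp
  have k1: "0 < \<kappa>1" "\<kappa>1 \<le> \<kappa>0" using k0 g01 L1 gr by (auto simp: \<kappa>1_def)
  have "\<gamma> - \<rho> \<le> L1 * \<Gamma> (0, 1) / \<kappa>1"
  proof -
    have "\<kappa>1 \<le> L1 * \<Gamma> (0, 1) / (\<gamma> - \<rho>)" by (simp add: \<kappa>1_def)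
    then show ?thesis using k1 gr by (simp add: field_simps)
  qed
  also have "\<dots> = (L1 / \<kappa>1 + 0) * \<Gamma> (0, 1)" by simp
  also have "\<dots> \<le> h \<kappa>1"
    unfolding h_def using k1 L1 L2 by (intro mult_mono \<Gamma>_mono add_mono) auto
  finally have bot: "\<gamma> - \<rho> \<le> h \<kappa>1" .
  have "continuous_on {\<kappa>1..\<kappa>0} h"
    unfolding h_def using k1 by (intro continuous_intros \<Gamma>_fst_continuous) auto
  then obtain \<kappa> where \<kappa>: "\<kappa>1 \<le> \<kappa>" "\<kappa> \<le> \<kappa>0" "h \<kappa> = \<gamma> - \<rho>"
    using IVT2'[of h \<kappa>0 "\<gamma> - \<rho>" \<kappa>1] top bot k1 by auto
  moreover have "\<kappa> \<noteq> \<kappa>0" using \<kappa> top by auto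
  ultimately show ?thesis
    using k1 h_eq[of \<kappa>] unfolding admissible_slope_def \<kappa>0_def by (intro exI[of _ \<kappa>]) auto
qed

section \<open>The adapted norm and its equivalence with the norm of X\<close>

definition nX :: "real \<Rightarrow> 'a \<Rightarrow> real" where
  "nX t x = \<Gamma> (nN t x, nS t x)"

lemma nX_nonneg [simp]: "0 \<le> nX t x"
  by (simp add: nX_def)

lemma nX_scale: "0 < c \<Longrightarrow> nX t (c *\<^sub>R x) = c * nX t x"
  by (simp add: nX_def nN_scale nS_scale \<Gamma>_scale)

lemma nX_diff_le: "nX t (x - y) \<le> nX t x + nX t y"
proof -
  have "nN t (x - y) \<le> nN t x + nN t y" "nS t (x - y) \<le> nS t x + nS t y"
    using nN_add[of t x "- y"] nS_add[of t x "- y"] nN_minus nS_minus by auto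
  then have "nX t (x - y) \<le> \<Gamma> (nN t x + nN t y, nS t x + nS t y)"
    unfolding nX_def by (intro \<Gamma>_mono) auto
  also have "\<dots> \<le> nX t x + nX t y" unfolding nX_def by (rule \<Gamma>_add)
  finally show ?thesis .
qed

lemma nX_le_norm: "nX t x \<le> M * \<Gamma> (1, 1) * norm x"
proof -
  have "nX t x \<le> \<Gamma> ((M * norm x) * 1, (M * norm x) * 1)"
    unfolding nX_def by (rule \<Gamma>_mono) (use nN_le_norm nS_le_norm in auto)
  also have "\<dots> = M * norm x * \<Gamma> (1, 1)" using M_ge_1 by (intro \<Gamma>_scale) auto
  finally show ?thesis by (simp add: mult_ac)
qed

text \<open>By monotonicity \<open>nX t x\<close> dominates \<open>nN t x * \<Gamma> (1, 0)\<close>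
  and \<open>nS t x * \<Gamma> (0, 1)\<close>; the resulting constant is the same for all
  times.\<close>

definition c_eq :: real where "c_eq = 1 / \<Gamma> (1, 0) + 1 / \<Gamma> (0, 1)"

lemma c_eq_pos: "0 < c_eq"
  unfolding c_eq_def by (intro add_pos_pos divide_pos_pos \<Gamma>_pos) auto

lemma norm_le_nX: "norm x \<le> c_eq * nX t x"
proof -
  have "nN t x \<le> nX t x / \<Gamma> (1, 0)" "nS t x \<le> nX t x / \<Gamma> (0, 1)"
    unfolding nX_def using \<Gamma>_fst_le[of "nN t x" "nS t x"] \<Gamma>_snd_le[of "nN t x" "nS t x"]
    by (auto simp: pos_le_divide_eq \<Gamma>_pos)
  then show ?thesis using norm_le_nN_nS[of x t] by (simp add: c_eq_def distrib_right)
qed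

text \<open>Abstracts the difference \<open>w\<close> of two solutions: as \<open>f\<close> is
  nonlinear, \<open>w\<close> need not solve an equation of the same form, and these bounds are the
  link between \<open>w\<close> and its inhomogeneity \<open>g\<close>.\<close>

definition Lip :: "real \<Rightarrow> (real \<Rightarrow> 'a) \<Rightarrow> (real \<Rightarrow> 'a) \<Rightarrow> bool" where
  "Lip \<tau> w g \<longleftrightarrow> (\<forall>s\<ge>\<tau>. nN s (g s) \<le> L1 * nX s (w s) \<and> nS s (g s) \<le> L2 * nX s (w s))"

text \<open>Supplies the hypothesis \<open>lim\<close> of \<open>nN_voc\<close>: backward growth at
  rate \<rho> loses against decay at rate \<sigma>.\<close>

lemma B_tendsto_0:
  assumes "\<And>s. \<tau> \<le> s \<Longrightarrow> exp (\<sigma> * (s - \<tau>)) * nX s (w s) \<le> m" and "\<tau> \<le> t"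
  shows "(\<lambda>n. B t (\<tau> + real n) (w (\<tau> + real n))) \<longlonglongrightarrow> 0"
proof (rule Lim_null_comparison)
  have le: "norm (B t s (w s)) \<le> (M * exp (\<rho> * (\<tau> - t)) * c_eq * m) * exp (- (\<sigma> - \<rho>) * (s - \<tau>))" if "t \<le> s" for s
  proof -
    have "norm (B t s (w s)) \<le> M * exp (\<rho> * (s - t)) * norm (w s)" by (rule B_bound'[OF that])
    also have "\<dots> \<le> M * exp (\<rho> * (s - t)) * (c_eq * nX s (w s))"
      using M_ge_1 by (intro mult_left_mono norm_le_nX) auto
    also have "\<dots> \<le> M * exp (\<rho> * (s - t)) * (c_eq * (exp (- \<sigma> * (s - \<tau>)) * m))"
    proof -
      have "nX s (w s) = exp (- \<sigma> * (s - \<tau>)) * (exp (\<sigma> * (s - \<tau>)) * nX s (w s))"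
        by (simp flip: exp_add mult.assoc)
      also have "\<dots> \<le> exp (- \<sigma> * (s - \<tau>)) * m" using assms that by (intro mult_left_mono) auto
      finally show ?thesis using M_ge_1 c_eq_pos by (intro mult_left_mono) auto
    qed
    also have "\<dots> = M * c_eq * m * (exp (\<rho> * (s - t)) * exp (- \<sigma> * (s - \<tau>)))" by (simp add: mult_ac)
    also have "exp (\<rho> * (s - t)) * exp (- \<sigma> * (s - \<tau>)) = exp (\<rho> * (\<tau> - t)) * exp (- (\<sigma> - \<rho>) * (s - \<tau>))"
      by (simp add: algebra_simps flip: exp_add)
    finally show ?thesis by (simp add: mult_ac)
  qed
  obtain N :: nat where N: "t - \<tau> \<le> real N" using real_arch_simple by blast
  show "\<forall>\<^sub>F n in sequentially. norm (B t (\<tau> + real n) (w (\<tau> + real n)))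
      \<le> (M * exp (\<rho> * (\<tau> - t)) * c_eq * m) * exp (- (\<sigma> - \<rho>) * real n)"
    using eventually_ge_at_top[of N]
  proof eventually_elim
    case (elim n)
    then have "t \<le> \<tau> + real n" using N by linarith
    then show ?case using le[of "\<tau> + real n"] by simp
  qed
  have "(\<lambda>n. exp (- (\<sigma> - \<rho>)) ^ n) \<longlonglongrightarrow> 0"
    using rho_sigma by (intro LIMSEQ_power_zero) auto
  then have "(\<lambda>n. exp (- (\<sigma> - \<rho>) * real n)) \<longlonglongrightarrow> 0"
    by (simp add: mult.commute flip: exp_of_nat_mult)
  then show "(\<lambda>n. (M * exp (\<rho> * (\<tau> - t)) * c_eq * m) * exp (- (\<sigma> - \<rho>) * real n)) \<longlonglongrightarrow> 0"
    by (rule tendsto_mult_right_zero)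
qed

text \<open>The pair \<open>(\<kappa>, 1) * exp (- \<beta> (t - \<tau>))\<close> is an exact fixed point of the monotone operator that
  bounds the two components of \<open>w\<close>; an excess of size \<open>m * exp (- \<sigma> (t - \<tau>))\<close> over it shrinks by
  the factor \<open>q < 1\<close> of the gap condition at each application.\<close>

lemma comparison:
  assumes w: "voc \<tau> w g" and lip: "Lip \<tau> w g"
    and bound: "\<And>s. \<tau> \<le> s \<Longrightarrow> exp (\<sigma> * (s - \<tau>)) * nX s (w s) \<le> m0"
    and \<kappa>: "admissible_slope \<kappa>" and t: "\<tau> \<le> t"
  defines "\<beta> \<equiv> \<gamma> - L2 * \<Gamma> (\<kappa>, 1)"
  shows "nN t (w t) \<le> \<kappa> * nS \<tau> (w \<tau>) * exp (- \<beta> * (t - \<tau>))"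
    and "nS t (w t) \<le> nS \<tau> (w \<tau>) * exp (- \<beta> * (t - \<tau>))"
proof -
  define b0 where "b0 = nS \<tau> (w \<tau>)"
  define a1 where "a1 = L1 / (\<sigma> - \<rho>)"
  define a2 where "a2 = L2 / (\<gamma> - \<sigma>)"
  define q where "q = \<Gamma> (a1, a2)"
  define C where "C = \<Gamma> (\<kappa>, 1) * b0"
  have pos: "0 < \<kappa>" "0 \<le> b0" "0 < a1" "0 < a2" "0 \<le> C" "0 < \<Gamma> (\<kappa>, 1)"
    using \<kappa> L1 L2 rho_sigma sigma_gamma
    by (auto simp: admissible_slope_def b0_def a1_def a2_def C_def \<Gamma>_pos)
  have q: "0 \<le> q" "q < 1" using gap by (auto simp: q_def a1_def a2_def)
  have sb: "\<sigma> < \<beta>" using \<Gamma>_slope_lt[of \<kappa>] \<kappa> by (simp add: \<beta>_def admissible_slope_def)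
  have bg: "\<beta> < \<gamma>" "\<gamma> - \<beta> = L2 * \<Gamma> (\<kappa>, 1)" using pos L2 by (auto simp: \<beta>_def)
  \<comment> \<open>The slope equation enters here; together with \<open>bg\<close> it makes both
    coefficients of the profile reproduce themselves in \<open>step\<close>.\<close>
  have rb: "\<beta> - \<rho> = L1 * \<Gamma> (\<kappa>, 1) / \<kappa>"
    using \<kappa> \<Gamma>_inverse_slope[OF pos(1)] by (simp add: \<beta>_def admissible_slope_def)
  have step: "nN t (w t) \<le> \<kappa> * b0 * exp (- \<beta> * (t - \<tau>)) + m * a1 * exp (- \<sigma> * (t - \<tau>))"
    "nS t (w t) \<le> b0 * exp (- \<beta> * (t - \<tau>)) + m * a2 * exp (- \<sigma> * (t - \<tau>))"
    if m: "0 \<le> m" and t: "\<tau> \<le> t"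
      and X: "\<And>s. \<tau> \<le> s \<Longrightarrow> nX s (w s) \<le> C * exp (- \<beta> * (s - \<tau>)) + m * exp (- \<sigma> * (s - \<tau>))" for m t
  proof -
    have "nN s (g s) \<le> L1 * C * exp (- \<beta> * (s - \<tau>)) + L1 * m * exp (- \<sigma> * (s - \<tau>))" if "\<tau> \<le> s" for s
    proof -
      have "nN s (g s) \<le> L1 * nX s (w s)" using lip that unfolding Lip_def by blast
      also have "\<dots> \<le> L1 * (C * exp (- \<beta> * (s - \<tau>)) + m * exp (- \<sigma> * (s - \<tau>)))"
        using X[OF that] L1 by (intro mult_left_mono) auto
      finally show ?thesis by (simp add: distrib_left)
    qed
    then have "nN t (w t) \<le> L1 * C / (\<beta> - \<rho>) * exp (- \<beta> * (t - \<tau>)) + L1 * m / (\<sigma> - \<rho>) * exp (- \<sigma> * (t - \<tau>))"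
      using B_tendsto_0[OF bound t] m pos L1 sb rho_sigma by (intro nN_voc[OF w t]) auto
    moreover have "L1 * C / (\<beta> - \<rho>) = \<kappa> * b0" unfolding rb C_def using pos L1 by simp
    ultimately show "nN t (w t) \<le> \<kappa> * b0 * exp (- \<beta> * (t - \<tau>)) + m * a1 * exp (- \<sigma> * (t - \<tau>))"
      by (simp only: a1_def mult.commute[of L1 m] times_divide_eq_right)
    have "nS s (g s) \<le> L2 * C * exp (- \<beta> * (s - \<tau>)) + L2 * m * exp (- \<sigma> * (s - \<tau>))" if "\<tau> \<le> s" for s
    proof -
      have "nS s (g s) \<le> L2 * nX s (w s)" using lip that unfolding Lip_def by blast
      also have "\<dots> \<le> L2 * (C * exp (- \<beta> * (s - \<tau>)) + m * exp (- \<sigma> * (s - \<tau>)))"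
        using X[OF that] L2 by (intro mult_left_mono) auto
      finally show ?thesis by (simp add: distrib_left)
    qed
    then have "nS t (w t) \<le> exp (- \<gamma> * (t - \<tau>)) * nS \<tau> (w \<tau>) +
        L2 * C / (\<gamma> - \<beta>) * (exp (- \<beta> * (t - \<tau>)) - exp (- \<gamma> * (t - \<tau>))) + L2 * m / (\<gamma> - \<sigma>) * exp (- \<sigma> * (t - \<tau>))"
      using m pos L2 bg sigma_gamma by (intro nS_voc[OF w t]) auto
    also have "L2 * C / (\<gamma> - \<beta>) = b0" unfolding bg C_def using pos L2 by simp
    finally show "nS t (w t) \<le> b0 * exp (- \<beta> * (t - \<tau>)) + m * a2 * exp (- \<sigma> * (t - \<tau>))"
      by (simp add: a2_def b0_def right_diff_distrib mult.commute)
  qed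
  define m where "m = \<bar>m0\<bar>"
  have X: "nX t (w t) \<le> C * exp (- \<beta> * (t - \<tau>)) + (q ^ n * m) * exp (- \<sigma> * (t - \<tau>))" if "\<tau> \<le> t" for n t
    using that
  proof (induction n arbitrary: t)
    case 0
    have "nX t (w t) = exp (- \<sigma> * (t - \<tau>)) * (exp (\<sigma> * (t - \<tau>)) * nX t (w t))"
      by (simp flip: exp_add mult.assoc)
    also have "\<dots> \<le> exp (- \<sigma> * (t - \<tau>)) * m"
      using bound[OF 0] unfolding m_def by (intro mult_left_mono) auto
    also have "\<dots> \<le> C * exp (- \<beta> * (t - \<tau>)) + exp (- \<sigma> * (t - \<tau>)) * m" using pos by simp
    finally show ?case by (simp add: mult.commute)
  next
    case (Suc n)
    let ?u = "exp (- \<beta> * (t - \<tau>)) * b0" and ?v = "exp (- \<sigma> * (t - \<tau>)) * (q ^ n * m)"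
    have m0: "0 \<le> q ^ n * m" using q by (simp add: m_def)
    have "nX t (w t) \<le> \<Gamma> (?u * \<kappa> + ?v * a1, ?u * 1 + ?v * a2)"
      unfolding nX_def using step[OF m0 Suc.prems Suc.IH] by (intro \<Gamma>_mono) (auto simp: mult_ac)
    \<comment> \<open>Subadditivity separates the profile, which returns unchanged, from the excess,
      which gains a factor \<open>q\<close>.\<close>
    also have "\<dots> \<le> \<Gamma> (?u * \<kappa>, ?u * 1) + \<Gamma> (?v * a1, ?v * a2)" by (rule \<Gamma>_add)
    also have "\<dots> = ?u * \<Gamma> (\<kappa>, 1) + ?v * q"
      using pos m0 by (subst (1 2) \<Gamma>_scale) (auto simp: q_def)
    finally show ?case by (simp add: C_def mult_ac)
  qed
  have lim: "(\<lambda>n. c + (q ^ n * m) * d) \<longlonglongrightarrow> c" for c d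
  proof -
    have "(\<lambda>n. q ^ n) \<longlonglongrightarrow> 0" using q by (intro LIMSEQ_power_zero) auto
    then have "(\<lambda>n. c + (q ^ n * m) * d) \<longlonglongrightarrow> c + (0 * m) * d"
      by (rule tendsto_add[OF tendsto_const tendsto_mult_right[OF tendsto_mult_right]])
    then show ?thesis by simp
  qed
  have m0: "0 \<le> q ^ n * m" for n using q by (simp add: m_def)
  show "nN t (w t) \<le> \<kappa> * nS \<tau> (w \<tau>) * exp (- \<beta> * (t - \<tau>))"
    using step(1)[OF m0 t X] unfolding b0_def[symmetric]
    by (intro LIMSEQ_le_const[OF lim[of _ "a1 * exp (- \<sigma> * (t - \<tau>))"]]) (auto simp: mult.assoc)
  show "nS t (w t) \<le> nS \<tau> (w \<tau>) * exp (- \<beta> * (t - \<tau>))"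
    using step(2)[OF m0 t X] unfolding b0_def[symmetric]
    by (intro LIMSEQ_le_const[OF lim[of _ "a2 * exp (- \<sigma> * (t - \<tau>))"]]) (auto simp: mult.assoc)
qed

end

section \<open>The Lyapunov--Perron fixed point\<close>

text \<open>The increments are dominated by those of the explicit exponential integrals, so the
  Cauchy property transfers.\<close>

lemma convergent_integral_exp_bound:
  fixes h :: "real \<Rightarrow> 'a::banach"
  assumes int: "\<And>b. h integrable_on {\<tau>..b}" and k: "0 < k"
    and le: "\<And>s. \<tau> \<le> s \<Longrightarrow> norm (h s) \<le> c * exp (- k * (s - \<tau>))"
  shows "convergent (\<lambda>n. integral {\<tau>..\<tau> + real n} h)"
proof -
  let ?J = "\<lambda>n. integral {\<tau>..\<tau> + real n} h"
  let ?e = "\<lambda>s. c * exp (- k * (s - \<tau>))"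
  let ?E = "\<lambda>n. integral {\<tau>..\<tau> + real n} ?e"
  have hE: "(?e has_integral c * ((1 - exp (- k * (b - \<tau>))) / k)) {\<tau>..b}" if "\<tau> \<le> b" for b
    by (rule has_integral_scaled_exp) (use that k in auto)
  have ei: "?e integrable_on {\<tau>..b}" for b
    by (intro integrable_continuous_interval continuous_intros)
  have "(\<lambda>n. c * ((1 - exp (- k) ^ n) / k)) \<longlonglongrightarrow> c * ((1 - 0) / k)"
    using k by (intro tendsto_intros LIMSEQ_power_zero) auto
  moreover have "?E n = c * ((1 - exp (- k) ^ n) / k)" for n
    using integral_unique[OF hE[of "\<tau> + real n"]] by (simp add: mult.commute flip: exp_of_nat_mult)
  ultimately have "Cauchy ?E" by (auto intro: LIMSEQ_imp_Cauchy)
  moreover have le2: "norm (?J n - ?J m) \<le> \<bar>?E n - ?E m\<bar>" if "m \<le> n" for m n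
  proof -
    have "?J m + integral {\<tau> + real m..\<tau> + real n} h = ?J n"
      "?E m + integral {\<tau> + real m..\<tau> + real n} ?e = ?E n"
      using that by (intro Henstock_Kurzweil_Integration.integral_combine int ei; simp)+
    moreover have "norm (integral {\<tau> + real m..\<tau> + real n} h) \<le> integral {\<tau> + real m..\<tau> + real n} ?e"
      by (intro integral_norm_bound_integral integrable_on_subinterval[OF int[of "\<tau> + real n"]]
          integrable_on_subinterval[OF ei[of "\<tau> + real n"]] le) auto
    ultimately show ?thesis by (smt (verit) add_diff_cancel_left')
  qed
  then have le3: "norm (?J n - ?J m) \<le> norm (?E n - ?E m)" for m n
    using linorder_linear[of m n] by (metis norm_minus_commute real_norm_def)
  ultimately have "Cauchy ?J"
    unfolding Cauchy_def dist_norm by (meson le3 order_le_less_trans)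
  then show ?thesis by (rule Cauchy_convergent)
qed

locale lyapunov_perron = spectral_gap L Q M \<gamma> \<rho> \<Gamma> L1 L2 \<sigma>
  for L :: "real \<Rightarrow> real \<Rightarrow> ('a::banach \<Rightarrow>\<^sub>L 'a)" and Q M \<gamma> \<rho> \<Gamma> L1 L2 \<sigma> +
  fixes f :: "real \<Rightarrow> 'a \<Rightarrow> 'a"
  assumes f_cont: "continuous_on UNIV (\<lambda>(t, u). f t u)"
    and f_zero: "f t 0 = 0"
    and f_N: "nN t (f t u - f t v) \<le> L1 * nX t (u - v)"
    and f_S: "nS t (f t u - f t v) \<le> L2 * nX t (u - v)"
begin

lemma f_continuous: "continuous_on A z \<Longrightarrow> continuous_on A (\<lambda>s. f s (z s))"
  by (rule continuous_on_compose2[OF f_cont, of A "\<lambda>s. (s, z s)", simplified]) (auto intro: continuous_intros)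

lemma Lip_f: "Lip \<tau> (\<lambda>s. u s - v s) (\<lambda>s. f s (u s) - f s (v s))"
  unfolding Lip_def using f_N f_S by blast

definition Kf :: real where "Kf = (L1 + L2) * (M * \<Gamma> (1, 1))"

lemma f_Lipschitz: "norm (f t u - f t v) \<le> Kf * norm (u - v)"
proof -
  have "norm (f t u - f t v) \<le> (L1 + L2) * nX t (u - v)"
    using norm_le_nN_nS[of "f t u - f t v" t] f_N[of t u v] f_S[of t u v] by (simp add: distrib_right)
  also have "\<dots> \<le> (L1 + L2) * (M * \<Gamma> (1, 1) * norm (u - v))"
    using L1 L2 by (intro mult_left_mono nX_le_norm) auto
  finally show ?thesis by (simp add: Kf_def mult.assoc)
qed

lemma f_growth: "norm (f t u) \<le> Kf * norm u"
  using f_Lipschitz[of t u 0] by (simp add: f_zero)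

text \<open>Later identifies the fixed point, known only as a solution of the variation of constants
  formula, with an orbit of the process.\<close>

lemma solution_unique:
  assumes "voc \<tau> z (\<lambda>s. f s (z s))" "voc \<tau> z' (\<lambda>s. f s (z' s))" "z \<tau> = z' \<tau>" "\<tau> \<le> t"
  shows "z t = z' t"
  using voc_zero_unique[OF voc_diff[OF assms(1,2)] _ f_Lipschitz assms(4)] assms(3) by simp

context
  fixes \<tau> :: real and \<xi> :: 'a
  assumes \<xi>: "Q \<tau> \<xi> = 0"
begin

text \<open>The Lyapunov--Perron operator \<open>F\<close> acts on bounded functions \<open>y\<close>, which encode \<open>\<sigma>\<close>-decaying
  candidates \<open>exp (- \<sigma> (s - \<tau>)) y(s)\<close> on \<open>[\<tau>, \<infinity>)\<close> and are frozen to the left of \<open>\<tau>\<close>. Moving the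
  integral over \<open>[t, \<infinity>)\<close> into the initial value \<open>\<xi> - lim (J y)\<close> makes \<open>V y\<close> satisfy a forward
  variation of constants formula.\<close>

definition unw :: "(real \<Rightarrow> 'a) \<Rightarrow> real \<Rightarrow> 'a" where
  "unw y s = exp (- \<sigma> * (s - \<tau>)) *\<^sub>R y s"

definition J :: "(real \<Rightarrow> 'a) \<Rightarrow> nat \<Rightarrow> 'a" where
  "J y n = integral {\<tau>..\<tau> + real n} (\<lambda>s. B \<tau> s (f s (unw y s)))"

definition V :: "(real \<Rightarrow> 'a) \<Rightarrow> real \<Rightarrow> 'a" where
  "V y t = L t \<tau> (\<xi> - lim (J y)) + integral {\<tau>..t} (\<lambda>s. L t s (f s (unw y s)))"

definition F :: "(real \<Rightarrow> 'a) \<Rightarrow> real \<Rightarrow> 'a" where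
  "F y t = exp (\<sigma> * (max t \<tau> - \<tau>)) *\<^sub>R V y (max t \<tau>)"

lemma unw_f_continuous: "y \<in> bcontfun \<Longrightarrow> continuous_on {\<tau>..} (\<lambda>s. f s (unw y s))"
  unfolding unw_def bcontfun_def
  by (intro f_continuous continuous_intros) (auto intro: continuous_on_subset)

lemma V_start: "V y \<tau> = \<xi> - lim (J y)"
  by (simp add: V_def)

lemma V_voc: "y \<in> bcontfun \<Longrightarrow> voc \<tau> (V y) (\<lambda>s. f s (unw y s))"
  unfolding voc_def V_start using unw_f_continuous by (simp add: V_def)

lemma J_convergent: assumes y: "y \<in> bcontfun" shows "J y \<longlonglongrightarrow> lim (J y)"
proof -
  obtain c where c: "\<And>s. norm (y s) \<le> c"
    using y unfolding bcontfun_def by (auto simp: bounded_iff)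
  have "convergent (\<lambda>n. integral {\<tau>..\<tau> + real n} (\<lambda>s. B \<tau> s (f s (unw y s))))"
  proof (rule convergent_integral_exp_bound)
    show "(\<lambda>s. B \<tau> s (f s (unw y s))) integrable_on {\<tau>..b}" for b
      by (rule B_apply_integrable[OF unw_f_continuous[OF y]]) auto
    show "0 < \<sigma> - \<rho>" using rho_sigma by simp
    fix s assume s: "\<tau> \<le> s"
    have Kf0: "0 \<le> Kf" using L1 L2 M_ge_1 by (simp add: Kf_def)
    have "norm (B \<tau> s (f s (unw y s))) \<le> M * exp (\<rho> * (s - \<tau>)) * norm (f s (unw y s))"
      using s by (rule B_bound')
    also have "\<dots> \<le> M * exp (\<rho> * (s - \<tau>)) * (Kf * (exp (- \<sigma> * (s - \<tau>)) * c))"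
      using M_ge_1 Kf0 c[of s]
      by (intro mult_left_mono order_trans[OF f_growth]) (auto simp: unw_def)
    also have "\<dots> = M * Kf * c * (exp (\<rho> * (s - \<tau>)) * exp (- \<sigma> * (s - \<tau>)))" by (simp add: mult_ac)
    also have "exp (\<rho> * (s - \<tau>)) * exp (- \<sigma> * (s - \<tau>)) = exp (- (\<sigma> - \<rho>) * (s - \<tau>))"
      by (simp add: algebra_simps flip: exp_add)
    finally show "norm (B \<tau> s (f s (unw y s))) \<le> M * Kf * c * exp (- (\<sigma> - \<rho>) * (s - \<tau>))" .
  qed
  then show ?thesis unfolding J_def by (rule convergent_LIMSEQ_iff[THEN iffD1])
qed

text \<open>Consequently subtracting \<open>lim (J y)\<close> from \<xi> leaves the stable component
  of the start value equal to \<xi>.\<close>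

lemma Q_lim_J: assumes y: "y \<in> bcontfun" shows "Q \<tau> (lim (J y)) = lim (J y)"
proof -
  have "Q \<tau> (J y n) = J y n" for n
  proof -
    have "Q \<tau> (J y n) = integral {\<tau>..\<tau> + real n} (blinfun_apply (Q \<tau>) \<circ> (\<lambda>s. B \<tau> s (f s (unw y s))))"
      unfolding J_def
      by (rule integral_linear[symmetric])
        (auto intro!: B_apply_integrable[OF unw_f_continuous[OF y]] blinfun.bounded_linear_right)
    also have "\<dots> = J y n" unfolding J_def by (rule integral_cong) auto
    finally show ?thesis .
  qed
  then have "(\<lambda>n. J y n) \<longlonglongrightarrow> Q \<tau> (lim (J y))"
    using blinfun.tendsto[OF tendsto_const J_convergent[OF y], of "Q \<tau>"] by simp
  then show ?thesis using J_convergent[OF y] LIMSEQ_unique by blast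
qed

lemma V_compl: "y \<in> bcontfun \<Longrightarrow> V y \<tau> - Q \<tau> (V y \<tau>) = \<xi>"
  by (simp add: V_start blinfun.diff_right \<xi> Q_lim_J)

lemma V_contraction:
  assumes y: "y \<in> bcontfun" "y' \<in> bcontfun" and d: "\<And>s. \<tau> \<le> s \<Longrightarrow> nX s (y s - y' s) \<le> d" and t: "\<tau> \<le> t"
  shows "nX t (V y t - V y' t) \<le> \<Gamma> (L1 / (\<sigma> - \<rho>), L2 / (\<gamma> - \<sigma>)) * d * exp (- \<sigma> * (t - \<tau>))"
proof -
  let ?w = "\<lambda>t. V y t - V y' t" and ?g = "\<lambda>s. f s (unw y s) - f s (unw y' s)"
  let ?e = "\<lambda>s. exp (- \<sigma> * (s - \<tau>))"
  have w: "voc \<tau> ?w ?g" by (intro voc_diff V_voc y)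
  have d0: "0 \<le> d" using d[of \<tau>] nX_nonneg order_trans by blast
  have z: "nX s (unw y s - unw y' s) \<le> d * ?e s" if "\<tau> \<le> s" for s
    using d[OF that] by (simp add: unw_def nX_scale mult.commute flip: scaleR_diff_right)
  have gN: "nN s (?g s) \<le> 0 * ?e s + (L1 * d) * ?e s" if "\<tau> \<le> s" for s
    using order_trans[OF f_N mult_left_mono[OF z[OF that], of L1]] L1 by (simp add: mult.assoc)
  have gS: "nS s (?g s) \<le> 0 * ?e s + (L2 * d) * ?e s" if "\<tau> \<le> s" for s
    using order_trans[OF f_S mult_left_mono[OF z[OF that], of L2]] L2 by (simp add: mult.assoc)
  \<comment> \<open>The start value was chosen for this: pulled back to \<tau>, the difference is
    \<open>J y n - lim (J y)\<close> minus the same expression for \<open>y'\<close>. The fixed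
    operator \<open>L t \<tau>\<close> then carries the limit to time \<open>t\<close>.\<close>
  have lim: "(\<lambda>n. B t (\<tau> + real n) (?w (\<tau> + real n))) \<longlonglongrightarrow> 0"
  proof -
    have "B \<tau> (\<tau> + real n) (?w (\<tau> + real n)) = (J y n - lim (J y)) - (J y' n - lim (J y'))" for n
    proof -
      have "integral {\<tau>..\<tau> + real n} (\<lambda>s. B \<tau> s (?g s)) =
          integral {\<tau>..\<tau> + real n} (\<lambda>s. B \<tau> s (f s (unw y s)) - B \<tau> s (f s (unw y' s)))"
        by (rule integral_cong) (auto simp: linear_diff[OF linear_B])
      also have "\<dots> = J y n - J y' n"
        unfolding J_def
        by (intro integral_diff B_apply_integrable[OF unw_f_continuous[OF y(1)]]
            B_apply_integrable[OF unw_f_continuous[OF y(2)]]) auto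
      finally show ?thesis
        using B_voc[OF w, of \<tau> "\<tau> + real n"]
        by (simp add: V_start blinfun.diff_right Q_lim_J y)
    qed
    moreover have "(\<lambda>n. (J y n - lim (J y)) - (J y' n - lim (J y'))) \<longlonglongrightarrow> (lim (J y) - lim (J y)) - (lim (J y') - lim (J y'))"
      by (intro tendsto_intros J_convergent y)
    ultimately have 0: "(\<lambda>n. B \<tau> (\<tau> + real n) (?w (\<tau> + real n))) \<longlonglongrightarrow> 0" by simp
    have 1: "(\<lambda>n. L t \<tau> (B \<tau> (\<tau> + real n) (?w (\<tau> + real n)))) \<longlonglongrightarrow> 0"
      using blinfun.tendsto[OF tendsto_const 0, of "L t \<tau>"] by simp
    obtain N :: nat where N: "t - \<tau> \<le> real N" using real_arch_simple by blast
    have "\<forall>\<^sub>F n in sequentially. L t \<tau> (B \<tau> (\<tau> + real n) (?w (\<tau> + real n))) = B t (\<tau> + real n) (?w (\<tau> + real n))"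
      using eventually_ge_at_top[of N]
    proof eventually_elim
      case (elim n)
      then show ?case using N t by (intro L_B_backward) linarith+
    qed
    then show ?thesis using 1 by (rule Lim_transform_eventually[rotated])
  qed
  have 1: "nN t (?w t) \<le> (d * ?e t) * (L1 / (\<sigma> - \<rho>))"
    using nN_voc[OF w t lim gN rho_sigma rho_sigma _ _] L1 d0 by (simp add: mult_ac)
  \<comment> \<open>Both start values have the stable component \<xi>.\<close>
  have w0: "nS \<tau> (?w \<tau>) = 0"
  proof -
    have "?w \<tau> - Q \<tau> (?w \<tau>) = 0"
      using y by (simp add: V_start blinfun.diff_right Q_lim_J \<xi>)
    then have "nS \<tau> (?w \<tau>) = nS \<tau> 0" unfolding nS_def by simp
    then show ?thesis by simp
  qed
  have 2: "nS t (?w t) \<le> (d * ?e t) * (L2 / (\<gamma> - \<sigma>))"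
    using nS_voc[OF w t gS sigma_gamma sigma_gamma _] L2 d0 w0 by (simp add: mult_ac)
  have "nX t (?w t) \<le> \<Gamma> ((d * ?e t) * (L1 / (\<sigma> - \<rho>)), (d * ?e t) * (L2 / (\<gamma> - \<sigma>)))"
    unfolding nX_def by (intro \<Gamma>_mono 1 2) auto
  also have "\<dots> = (d * ?e t) * \<Gamma> (L1 / (\<sigma> - \<rho>), L2 / (\<gamma> - \<sigma>))"
    using d0 by (intro \<Gamma>_scale) auto
  finally show ?thesis by (simp add: mult_ac)
qed

text \<open>A common pointwise bound \<open>d\<close> takes the place of a distance, because each
  value is measured in the norm of its own time \<open>max t \<tau>\<close>.\<close>

lemma F_contraction:
  assumes y: "y \<in> bcontfun" "y' \<in> bcontfun" and d: "\<And>s. nX (max s \<tau>) (y s - y' s) \<le> d"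
  shows "nX (max t \<tau>) (F y t - F y' t) \<le> \<Gamma> (L1 / (\<sigma> - \<rho>), L2 / (\<gamma> - \<sigma>)) * d"
proof -
  let ?t = "max t \<tau>"
  have "nX s (y s - y' s) \<le> d" if "\<tau> \<le> s" for s using d[of s] that by (simp add: max_def)
  then have "nX ?t (V y ?t - V y' ?t) \<le> \<Gamma> (L1 / (\<sigma> - \<rho>), L2 / (\<gamma> - \<sigma>)) * d * exp (- \<sigma> * (?t - \<tau>))"
    by (intro V_contraction[OF y]) auto
  then have "exp (\<sigma> * (?t - \<tau>)) * nX ?t (V y ?t - V y' ?t)
      \<le> exp (\<sigma> * (?t - \<tau>)) * (\<Gamma> (L1 / (\<sigma> - \<rho>), L2 / (\<gamma> - \<sigma>)) * d * exp (- \<sigma> * (?t - \<tau>)))"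
    by (intro mult_left_mono) auto
  also have "\<dots> = \<Gamma> (L1 / (\<sigma> - \<rho>), L2 / (\<gamma> - \<sigma>)) * d"
    by (simp add: exp_minus)
  finally show ?thesis
    unfolding F_def by (simp add: nX_scale flip: scaleR_diff_right)
qed

lemma F_continuous: assumes "y \<in> bcontfun" shows "continuous_on UNIV (F y)"
proof -
  have "continuous_on UNIV (\<lambda>t. V y (max t \<tau>))"
    by (rule continuous_on_compose2[OF voc_continuous[OF V_voc[OF assms]]]) (auto intro!: continuous_intros)
  then show ?thesis unfolding F_def by (intro continuous_intros)
qed

lemma nX_bcontfun:
  assumes "y \<in> bcontfun" obtains d where "\<And>s t. nX t (y s) \<le> d"
proof -
  obtain c where c: "\<And>s. norm (y s) \<le> c"
    using assms unfolding bcontfun_def by (auto simp: bounded_iff)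
  have "nX t (y s) \<le> M * \<Gamma> (1, 1) * c" for s t
    using M_ge_1 by (intro order_trans[OF nX_le_norm] mult_left_mono c) auto
  then show ?thesis using that by blast
qed

lemma zero_bcontfun: "(\<lambda>_. 0) \<in> bcontfun"
  by (simp add: bcontfun_def)

lemma F_zero_bound: "norm (F (\<lambda>_. 0) t) \<le> M * norm \<xi>"
proof -
  let ?t = "max t \<tau>"
  have "J (\<lambda>_. 0) = (\<lambda>n. 0)"
    unfolding J_def
    by (rule ext, rule integral_unique, rule has_integral_is_0)
      (simp add: unw_def f_zero linear_0[OF linear_B])
  then have "lim (J (\<lambda>_. 0)) = 0" by simp
  then have "F (\<lambda>_. 0) t = exp (\<sigma> * (?t - \<tau>)) *\<^sub>R L ?t \<tau> (\<xi> - Q \<tau> \<xi>)"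
    by (simp add: F_def V_def unw_def f_zero \<xi>)
  then have "norm (F (\<lambda>_. 0) t) = exp (\<sigma> * (?t - \<tau>)) * norm (L ?t \<tau> (\<xi> - Q \<tau> \<xi>))" by simp
  also have "\<dots> \<le> exp (\<gamma> * (?t - \<tau>)) * norm (L ?t \<tau> (\<xi> - Q \<tau> \<xi>))"
    using sigma_gamma by (intro mult_right_mono) (auto intro: mult_right_mono)
  also have "\<dots> \<le> M * norm \<xi>" by (rule L_stable) auto
  finally show ?thesis .
qed

text \<open>The image of 0 is the weighted linear orbit of \<xi>, bounded because
  \<open>\<sigma> < \<gamma>\<close>; the contraction estimate carries boundedness over to every
  \<open>F y\<close>.\<close>

lemma F_bcontfun: assumes y: "y \<in> bcontfun" shows "F y \<in> bcontfun"
proof -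
  obtain d where d: "\<And>s t. nX t (y s) \<le> d" using nX_bcontfun[OF y] by blast
  have "norm (F y t) \<le> c_eq * (\<Gamma> (L1 / (\<sigma> - \<rho>), L2 / (\<gamma> - \<sigma>)) * d) + M * norm \<xi>" for t
  proof -
    have "norm (F y t - F (\<lambda>_. 0) t) \<le> c_eq * nX (max t \<tau>) (F y t - F (\<lambda>_. 0) t)"
      by (rule norm_le_nX)
    also have "\<dots> \<le> c_eq * (\<Gamma> (L1 / (\<sigma> - \<rho>), L2 / (\<gamma> - \<sigma>)) * d)"
      using c_eq_pos d by (intro mult_left_mono F_contraction y zero_bcontfun) auto
    finally show ?thesis
      using F_zero_bound[of t] norm_triangle_sub[of "F y t" "F (\<lambda>_. 0) t"] by linarith
  qed
  then show ?thesis using F_continuous[OF y] unfolding bcontfun_def by (auto simp: bounded_iff)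
qed

text \<open>In the sup norm \<open>F\<close> itself need not contract, since passing to the adapted
  norms and back costs \<open>c_eq * K\<close>. A high iterate does, and its unique fixed point is
  also fixed by \<open>G\<close>, because \<open>G\<close> commutes with its iterates.\<close>

lemma F_fixpoint: "\<exists>y\<in>bcontfun. F y = y"
proof -
  define q where "q = \<Gamma> (L1 / (\<sigma> - \<rho>), L2 / (\<gamma> - \<sigma>))"
  have q: "0 \<le> q" "q < 1" using gap by (auto simp: q_def)
  define G where "G y = Bcontfun (F (apply_bcontfun y))" for y
  have G: "apply_bcontfun (G y) = F (apply_bcontfun y)" for y
    unfolding G_def by (rule Bcontfun_inverse) (rule F_bcontfun[OF apply_bcontfun])
  define K where "K = M * \<Gamma> (1, 1)"
  have K: "0 \<le> K" using M_ge_1 by (simp add: K_def)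
  have iter: "nX (max t \<tau>) ((G ^^ n) y t - (G ^^ n) y' t) \<le> q ^ n * (K * dist y y')" for n y y' t
  proof (induction n arbitrary: t)
    case 0
    have "nX (max t \<tau>) (y t - y' t) \<le> K * norm (y t - y' t)" unfolding K_def by (rule nX_le_norm)
    also have "\<dots> \<le> K * dist y y'"
      using dist_bounded[of y t y'] K by (intro mult_left_mono) (auto simp: dist_norm)
    finally show ?case by simp
  next
    case (Suc n)
    show ?case
      using F_contraction[OF apply_bcontfun apply_bcontfun Suc.IH, of t] by (simp add: G q_def mult.assoc)
  qed
  have "(\<lambda>n. c_eq * (q ^ n * K)) \<longlonglongrightarrow> c_eq * (0 * K)"
    using q by (intro tendsto_intros LIMSEQ_power_zero) auto
  then have "\<forall>\<^sub>F n in sequentially. c_eq * (q ^ n * K) < 1"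
    by (rule order_tendstoD(2)) simp
  then obtain n where n: "c_eq * (q ^ n * K) < 1" using eventually_sequentially by auto
  have "dist ((G ^^ n) y) ((G ^^ n) y') \<le> c_eq * (q ^ n * K) * dist y y'" for y y'
  proof (rule dist_bound)
    fix t
    have "norm ((G ^^ n) y t - (G ^^ n) y' t) \<le> c_eq * nX (max t \<tau>) ((G ^^ n) y t - (G ^^ n) y' t)"
      by (rule norm_le_nX)
    also have "\<dots> \<le> c_eq * (q ^ n * (K * dist y y'))"
      using c_eq_pos by (intro mult_left_mono iter) auto
    finally show "dist ((G ^^ n) y t) ((G ^^ n) y' t) \<le> c_eq * (q ^ n * K) * dist y y'"
      by (simp add: dist_norm mult.assoc)
  qed
  moreover have "0 \<le> c_eq * (q ^ n * K)" using c_eq_pos q K by simp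
  ultimately have ex1: "\<exists>!y. (G ^^ n) y = y" using n by (intro banach_fix_type) auto
  then obtain y where y: "(G ^^ n) y = y" by blast
  then have "(G ^^ n) (G y) = G y" by (metis funpow_swap1)
  then have "G y = y" using ex1 y by blast
  then show ?thesis using G[of y] apply_bcontfun[of y] by metis
qed

lemma bounded_solution_exists:
  "\<exists>z m. voc \<tau> z (\<lambda>s. f s (z s)) \<and> z \<tau> - Q \<tau> (z \<tau>) = \<xi> \<and>
     (\<forall>s\<ge>\<tau>. exp (\<sigma> * (s - \<tau>)) * nX s (z s) \<le> m)"
proof -
  obtain y where y: "y \<in> bcontfun" "F y = y" using F_fixpoint by blast
  obtain d where d: "\<And>s t. nX t (y s) \<le> d" using nX_bcontfun[OF y(1)] by blast
  have yV: "y t = exp (\<sigma> * (t - \<tau>)) *\<^sub>R V y t" if "\<tau> \<le> t" for t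
    using fun_cong[OF y(2), of t] that by (simp add: F_def max_def split: if_splits)
  have unw: "unw y t = V y t" if "\<tau> \<le> t" for t
    unfolding unw_def yV[OF that] by (simp flip: exp_add)
  have "voc \<tau> (V y) (\<lambda>s. f s (V y s))"
    unfolding voc_def
  proof (intro conjI allI impI)
    show "continuous_on {\<tau>..} (\<lambda>s. f s (V y s))"
      by (rule continuous_on_eq[OF unw_f_continuous[OF y(1)]]) (simp add: unw)
    fix t assume t: "\<tau> \<le> t"
    have "integral {\<tau>..t} (\<lambda>s. L t s (f s (unw y s))) = integral {\<tau>..t} (\<lambda>s. L t s (f s (V y s)))"
      by (rule integral_cong) (simp add: unw)
    then show "V y t = L t \<tau> (V y \<tau>) + integral {\<tau>..t} (\<lambda>s. L t s (f s (V y s)))"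
      using voc_formula[OF V_voc[OF y(1)] t] by (rule subst)
  qed
  moreover have "exp (\<sigma> * (s - \<tau>)) * nX s (V y s) \<le> d" if "\<tau> \<le> s" for s
    using d[of s s] unfolding yV[OF that] by (simp add: nX_scale)
  ultimately show ?thesis using V_compl[OF y(1)] by blast
qed

end

end

section \<open>The stable manifold\<close>

locale semilinear_process = lyapunov_perron L Q M \<gamma> \<rho> \<Gamma> L1 L2 \<sigma> f
  for L :: "real \<Rightarrow> real \<Rightarrow> ('a::banach \<Rightarrow>\<^sub>L 'a)" and Q M \<gamma> \<rho> \<Gamma> L1 L2 \<sigma> f +
  fixes T :: "real \<Rightarrow> real \<Rightarrow> 'a \<Rightarrow> 'a"
  assumes T: "evolution_process T"
    and T_voc: "\<tau> \<le> t \<Longrightarrow> T t \<tau> \<eta> = L t \<tau> \<eta> + integral {\<tau>..t} (\<lambda>s. L t s (f s (T s \<tau> \<eta>)))"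
begin

definition stable :: "real \<Rightarrow> 'a set" where
  "stable t = {\<eta>. bdd_above ((\<lambda>r. exp (\<sigma> * r) * nX r (T r t \<eta>)) ` {t..})}"

lemma T_refl [simp]: "T t t \<eta> = \<eta>"
  using T unfolding evolution_process_def by blast

lemma T_comp: "\<tau> \<le> s \<Longrightarrow> s \<le> t \<Longrightarrow> T t s (T s \<tau> \<eta>) = T t \<tau> \<eta>"
  using T unfolding evolution_process_def by blast

lemma orbit_voc: "voc \<tau> (\<lambda>t. T t \<tau> \<eta>) (\<lambda>s. f s (T s \<tau> \<eta>))"
  unfolding voc_def
proof (intro conjI allI impI)
  show "continuous_on {\<tau>..} (\<lambda>s. f s (T s \<tau> \<eta>))"
    using T unfolding evolution_process_def by (intro f_continuous) blast
  fix t assume "\<tau> \<le> t"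
  then show "T t \<tau> \<eta> = L t \<tau> (T \<tau> \<tau> \<eta>) + integral {\<tau>..t} (\<lambda>s. L t s (f s (T s \<tau> \<eta>)))"
    using T_voc by simp
qed

lemma stable_iff: "\<eta> \<in> stable \<tau> \<longleftrightarrow> (\<exists>m. \<forall>r\<ge>\<tau>. exp (\<sigma> * (r - \<tau>)) * nX r (T r \<tau> \<eta>) \<le> m)"
proof -
  have eq: "exp (\<sigma> * (r - \<tau>)) * x = exp (\<sigma> * r) * x / exp (\<sigma> * \<tau>)" for r x
    by (simp add: right_diff_distrib exp_diff)
  have "\<eta> \<in> stable \<tau> \<longleftrightarrow> (\<exists>m. \<forall>r\<ge>\<tau>. exp (\<sigma> * r) * nX r (T r \<tau> \<eta>) \<le> m)"
    by (auto simp: stable_def bdd_above_def)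
  also have "\<dots> \<longleftrightarrow> (\<exists>m. \<forall>r\<ge>\<tau>. exp (\<sigma> * (r - \<tau>)) * nX r (T r \<tau> \<eta>) \<le> m)"
  proof (intro iffI; elim exE)
    fix m assume "\<forall>r\<ge>\<tau>. exp (\<sigma> * r) * nX r (T r \<tau> \<eta>) \<le> m"
    then show "\<exists>m. \<forall>r\<ge>\<tau>. exp (\<sigma> * (r - \<tau>)) * nX r (T r \<tau> \<eta>) \<le> m"
      unfolding eq by (intro exI[of _ "m / exp (\<sigma> * \<tau>)"]) (auto intro: divide_right_mono)
  next
    fix m assume "\<forall>r\<ge>\<tau>. exp (\<sigma> * (r - \<tau>)) * nX r (T r \<tau> \<eta>) \<le> m"
    then show "\<exists>m. \<forall>r\<ge>\<tau>. exp (\<sigma> * r) * nX r (T r \<tau> \<eta>) \<le> m"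
      unfolding eq by (intro exI[of _ "m * exp (\<sigma> * \<tau>)"]) (auto simp: pos_divide_le_eq)
  qed
  finally show ?thesis .
qed

lemma stable_invariant: assumes "\<tau> \<le> t" shows "T t \<tau> ` stable \<tau> \<subseteq> stable t"
proof
  fix \<zeta> assume "\<zeta> \<in> T t \<tau> ` stable \<tau>"
  then obtain \<eta> where \<eta>: "\<eta> \<in> stable \<tau>" "\<zeta> = T t \<tau> \<eta>" by blast
  have "(\<lambda>r. exp (\<sigma> * r) * nX r (T r t \<zeta>)) ` {t..} = (\<lambda>r. exp (\<sigma> * r) * nX r (T r \<tau> \<eta>)) ` {t..}"
    unfolding \<eta>(2) by (rule image_cong) (use assms in \<open>auto simp: T_comp\<close>)
  also have "bdd_above \<dots>"
    using \<eta>(1) assms unfolding stable_def by (auto elim!: bdd_above_mono)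
  finally show "\<zeta> \<in> stable t" by (simp add: stable_def)
qed

lemma stable_comparison:
  assumes \<kappa>: "admissible_slope \<kappa>" and \<eta>: "\<eta> \<in> stable \<tau>" "\<eta>' \<in> stable \<tau>" and t: "\<tau> \<le> t"
  defines "\<beta> \<equiv> \<gamma> - L2 * \<Gamma> (\<kappa>, 1)"
  shows "nN t (T t \<tau> \<eta> - T t \<tau> \<eta>') \<le> \<kappa> * nS \<tau> (\<eta> - \<eta>') * exp (- \<beta> * (t - \<tau>))"
    and "nS t (T t \<tau> \<eta> - T t \<tau> \<eta>') \<le> nS \<tau> (\<eta> - \<eta>') * exp (- \<beta> * (t - \<tau>))"
proof -
  obtain m where m: "\<And>r. \<tau> \<le> r \<Longrightarrow> exp (\<sigma> * (r - \<tau>)) * nX r (T r \<tau> \<eta>) \<le> m"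
    using \<eta>(1) stable_iff by blast
  obtain m' where m': "\<And>r. \<tau> \<le> r \<Longrightarrow> exp (\<sigma> * (r - \<tau>)) * nX r (T r \<tau> \<eta>') \<le> m'"
    using \<eta>(2) stable_iff by blast
  have bound: "exp (\<sigma> * (r - \<tau>)) * nX r (T r \<tau> \<eta> - T r \<tau> \<eta>') \<le> m + m'" if "\<tau> \<le> r" for r
  proof -
    have "exp (\<sigma> * (r - \<tau>)) * nX r (T r \<tau> \<eta> - T r \<tau> \<eta>')
        \<le> exp (\<sigma> * (r - \<tau>)) * (nX r (T r \<tau> \<eta>) + nX r (T r \<tau> \<eta>'))"
      by (intro mult_left_mono nX_diff_le) auto
    then show ?thesis using m[OF that] m'[OF that] by (simp add: distrib_left)
  qed
  note c = comparison[OF voc_diff[OF orbit_voc orbit_voc] Lip_f bound \<kappa> t, folded \<beta>_def]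
  show "nN t (T t \<tau> \<eta> - T t \<tau> \<eta>') \<le> \<kappa> * nS \<tau> (\<eta> - \<eta>') * exp (- \<beta> * (t - \<tau>))"
    using c(1) by simp
  show "nS t (T t \<tau> \<eta> - T t \<tau> \<eta>') \<le> nS \<tau> (\<eta> - \<eta>') * exp (- \<beta> * (t - \<tau>))"
    using c(2) by simp
qed

section \<open>The stable set as a graph\<close>

lemma T_zero: assumes "\<tau> \<le> t" shows "T t \<tau> 0 = 0"
proof -
  have "voc \<tau> (\<lambda>_. 0) (\<lambda>s. f s 0)" by (simp add: voc_def f_zero)
  from solution_unique[OF orbit_voc this _ assms, of 0] show ?thesis by simp
qed

lemma zero_stable: "0 \<in> stable \<tau>"
  unfolding stable_iff by (rule exI[of _ 0]) (simp add: T_zero nX_def, use \<Gamma>_scale[of 0 0 0] in simp)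

lemma stable_exists: "\<exists>\<eta>\<in>stable \<tau>. \<eta> - Q \<tau> \<eta> = u - Q \<tau> u"
proof -
  have "Q \<tau> (u - Q \<tau> u) = 0" by (simp add: blinfun.diff_right)
  from bounded_solution_exists[OF this] obtain z m where
    z: "voc \<tau> z (\<lambda>s. f s (z s))" "z \<tau> - Q \<tau> (z \<tau>) = u - Q \<tau> u"
       "\<And>s. \<tau> \<le> s \<Longrightarrow> exp (\<sigma> * (s - \<tau>)) * nX s (z s) \<le> m" by blast
  have eq: "T t \<tau> (z \<tau>) = z t" if "\<tau> \<le> t" for t
    using solution_unique[OF orbit_voc z(1) _ that] by simp
  have "z \<tau> \<in> stable \<tau>" unfolding stable_iff using z(3) eq by (metis order_refl)
  then show ?thesis using z(2) by blast
qed

text \<open>Equal stable components make the bound of \<open>stable_comparison\<close> vanish at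
  \<open>t = \<tau>\<close>, which forces the unstable components to agree.\<close>

lemma stable_unique:
  assumes "\<eta> \<in> stable \<tau>" "\<eta>' \<in> stable \<tau>" "\<eta> - Q \<tau> \<eta> = \<eta>' - Q \<tau> \<eta>'"
  shows "\<eta> = \<eta>'"
proof -
  obtain \<kappa> where \<kappa>: "admissible_slope \<kappa>" using slope_exists by blast
  have d: "(\<eta> - \<eta>') - Q \<tau> (\<eta> - \<eta>') = 0" using assms(3) by (simp add: blinfun.diff_right algebra_simps)
  then have "nS \<tau> (\<eta> - \<eta>') = nS \<tau> 0" unfolding nS_def by simp
  then have "nN \<tau> (\<eta> - \<eta>') \<le> 0"
    using stable_comparison(1)[OF \<kappa> assms(1,2) order_refl] by simp
  then have "Q \<tau> (\<eta> - \<eta>') = 0" by (intro nN_eq_0 antisym) auto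
  then show ?thesis using d by simp
qed

text \<open>The chosen point is unique by \<open>stable_unique\<close>. The predicate depends on
  \<open>u\<close> only through \<open>u - Q \<tau> u\<close>, so \<open>\<Theta>_compl\<close>
  compares two identical choices.\<close>

definition lift :: "real \<Rightarrow> 'a \<Rightarrow> 'a" where
  "lift \<tau> u = (SOME \<eta>. \<eta> \<in> stable \<tau> \<and> \<eta> - Q \<tau> \<eta> = u - Q \<tau> u)"

lemma lift: "lift \<tau> u \<in> stable \<tau>" "lift \<tau> u - Q \<tau> (lift \<tau> u) = u - Q \<tau> u"
proof -
  have "lift \<tau> u \<in> stable \<tau> \<and> lift \<tau> u - Q \<tau> (lift \<tau> u) = u - Q \<tau> u"
    unfolding lift_def by (rule someI_ex) (use stable_exists in blast)
  then show "lift \<tau> u \<in> stable \<tau>" "lift \<tau> u - Q \<tau> (lift \<tau> u) = u - Q \<tau> u" by auto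
qed

definition \<Theta> :: "real \<Rightarrow> 'a \<Rightarrow> 'a" where
  "\<Theta> \<tau> u = Q \<tau> (lift \<tau> u)"

lemma graph_map_\<Theta>: "graph_map Q \<Theta> \<tau> u = lift \<tau> u"
  by (simp add: graph_map_def \<Theta>_def lift(2)[symmetric, of u])

lemma stable_eq_range: "stable \<tau> = range (graph_map Q \<Theta> \<tau>)"
proof
  show "stable \<tau> \<subseteq> range (graph_map Q \<Theta> \<tau>)"
    using stable_unique[OF _ lift(1) lift(2)[symmetric]] by (auto simp: graph_map_\<Theta> intro: range_eqI)
qed (auto simp: graph_map_\<Theta> lift(1))

lemma \<Theta>_compl: "\<Theta> \<tau> (u - Q \<tau> u) = \<Theta> \<tau> u"
  by (simp add: \<Theta>_def lift_def blinfun.diff_right)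

lemma \<Theta>_zero: "\<Theta> \<tau> 0 = 0"
  unfolding \<Theta>_def using stable_unique[OF lift(1)[of \<tau> 0] zero_stable] lift(2)[of \<tau> 0]
  by (metis blinfun.zero_right)

text \<open>This is the comparison at the initial time, where the exponential is 1: the slope of the
  profile becomes the Lipschitz constant.\<close>

lemma \<Theta>_Lipschitz:
  assumes "admissible_slope \<kappa>"
  shows "N_norm L Q \<rho> t (\<Theta> t \<eta> - \<Theta> t \<eta>') \<le> \<kappa> * nS t (\<eta> - \<eta>')"
proof -
  have "lift t \<eta> - lift t \<eta>' - Q t (lift t \<eta> - lift t \<eta>') = (\<eta> - \<eta>') - Q t (\<eta> - \<eta>')"
    using arg_cong2[of _ _ _ _ minus, OF lift(2)[of t \<eta>] lift(2)[of t \<eta>']]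
    by (simp only: blinfun.diff_right diff_diff_eq2 diff_diff_eq add_diff_eq diff_add_eq ac_simps)
  then have "nS t (lift t \<eta> - lift t \<eta>') = nS t (\<eta> - \<eta>')" by (simp add: nS_def)
  moreover have "N_norm L Q \<rho> t (\<Theta> t \<eta> - \<Theta> t \<eta>') = nN t (lift t \<eta> - lift t \<eta>')"
    by (simp add: nN_def \<Theta>_def blinfun.diff_right)
  ultimately show ?thesis
    using stable_comparison(1)[OF assms lift(1) lift(1) order_refl, of t \<eta> \<eta>'] by simp
qed

text \<open>Comparison with the zero orbit. The factor \<open>\<Gamma> (\<kappa>, 1)\<close>
  assembles the two decaying components, and \<open>\<Gamma> (0, 1)\<close> arises from bounding the
  initial stable component by the full norm.\<close>

lemma stable_decay:
  assumes \<kappa>: "admissible_slope \<kappa>" and t: "\<tau> \<le> t" and \<eta>: "\<eta> \<in> stable \<tau>"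
  shows "nX t (T t \<tau> \<eta>) \<le> \<Gamma> (\<kappa>, 1) / \<Gamma> (0, 1) * exp (- (\<gamma> - L2 * \<Gamma> (\<kappa>, 1)) * (t - \<tau>)) * nX \<tau> \<eta>"
proof -
  let ?e = "exp (- (\<gamma> - L2 * \<Gamma> (\<kappa>, 1)) * (t - \<tau>))"
  have "nX t (T t \<tau> \<eta>) \<le> \<Gamma> ((nS \<tau> \<eta> * ?e) * \<kappa>, (nS \<tau> \<eta> * ?e) * 1)"
    unfolding nX_def using stable_comparison[OF \<kappa> \<eta> zero_stable t]
    by (intro \<Gamma>_mono) (auto simp: T_zero[OF t] mult_ac)
  also have "\<dots> = nS \<tau> \<eta> * ?e * \<Gamma> (\<kappa>, 1)" by (intro \<Gamma>_scale) auto
  also have "nS \<tau> \<eta> \<le> nX \<tau> \<eta> / \<Gamma> (0, 1)"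
    using \<Gamma>_snd_le[of "nN \<tau> \<eta>" "nS \<tau> \<eta>"] \<Gamma>_pos[of 0 1] by (simp add: nX_def pos_le_divide_eq)
  finally show ?thesis by (simp add: mult_ac mult_right_mono)
qed

end

theorem theorem4p1:
  fixes L :: "real \<Rightarrow> real \<Rightarrow> ('a::banach \<Rightarrow>\<^sub>L 'a)"
    and Q :: "real \<Rightarrow> ('a \<Rightarrow>\<^sub>L 'a)"
    and T :: "real \<Rightarrow> real \<Rightarrow> 'a \<Rightarrow> 'a"
    and f :: "real \<Rightarrow> 'a \<Rightarrow> 'a"
    and \<Gamma> :: "real \<times> real \<Rightarrow> real"
    and M \<gamma> \<rho> \<sigma> L1 L2 :: real
  assumes "linear_evolution_process L"
    and "exponential_splitting L Q M \<gamma> \<rho>"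
    and "admissible_norm \<Gamma>"
    and "continuous_on UNIV (\<lambda>(t, u). f t u)"
    and "\<And>t. f t 0 = 0"
    and "0 < L1" and "0 < L2"
    and "\<And>t u v. N_norm L Q \<rho> t (Q t (f t u - f t v))
                   \<le> L1 * adapted_norm \<Gamma> L Q \<gamma> \<rho> t (u - v)"
    and "\<And>t u v. S_norm L \<gamma> t ((f t u - f t v) - Q t (f t u - f t v))
                   \<le> L2 * adapted_norm \<Gamma> L Q \<gamma> \<rho> t (u - v)"
    and "evolution_process T"
    and "\<And>t \<tau> \<eta>. \<tau> \<le> t \<Longrightarrow>
           T t \<tau> \<eta> = L t \<tau> \<eta> + integral {\<tau>..t} (\<lambda>s. L t s (f s (T s \<tau> \<eta>)))"
    and "\<rho> < \<sigma>" and "\<sigma> < \<gamma>"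
    and "\<Gamma> (L1 / (\<sigma> - \<rho>), L2 / (\<gamma> - \<sigma>)) < 1"
  shows "\<exists>S :: real \<Rightarrow> 'a set.
    (\<forall>t. S t = {\<eta>. bdd_above ((\<lambda>r. exp (\<sigma> * r) * adapted_norm \<Gamma> L Q \<gamma> \<rho> r (T r t \<eta>)) ` {t..})}) \<and>
    (\<forall>t \<tau>. \<tau> \<le> t \<longrightarrow> T t \<tau> ` S \<tau> \<subseteq> S t) \<and>
    (\<exists>(\<Theta> :: real \<Rightarrow> 'a \<Rightarrow> 'a) (\<kappa> :: real).
       (\<forall>t. S t = range (graph_map Q \<Theta> t)) \<and>
       (\<forall>t u. \<Theta> t u = \<Theta> t (u - Q t u) \<and> \<Theta> t u = Q t (\<Theta> t u)) \<and>
       (\<forall>t. \<Theta> t 0 = 0) \<and>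
       0 < \<kappa> \<and> \<kappa> < L1 / L2 * ((\<gamma> - \<sigma>) / (\<sigma> - \<rho>)) \<and>
       \<gamma> - \<rho> = L1 * \<Gamma> (1, 1 / \<kappa>) + L2 * \<Gamma> (\<kappa>, 1) \<and>
       (\<forall>t \<eta> \<eta>'. N_norm L Q \<rho> t (\<Theta> t \<eta> - \<Theta> t \<eta>')
                     \<le> \<kappa> * S_norm L \<gamma> t ((\<eta> - \<eta>') - Q t (\<eta> - \<eta>'))) \<and>
       (\<forall>t \<tau> u. \<tau> \<le> t \<longrightarrow>
          adapted_norm \<Gamma> L Q \<gamma> \<rho> t (T t \<tau> (graph_map Q \<Theta> \<tau> u))
            \<le> \<Gamma> (\<kappa>, 1) / \<Gamma> (0, 1) * exp (- (\<gamma> - L2 * \<Gamma> (\<kappa>, 1)) * (t - \<tau>))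
               * adapted_norm \<Gamma> L Q \<gamma> \<rho> \<tau> (graph_map Q \<Theta> \<tau> u)))"
proof -
  \<comment> \<open>The interpretation has two stages because the hypotheses on \<open>f\<close> are
    stated with \<open>adapted_norm\<close>, which is first identified with
    \<open>nX\<close>.\<close>
  interpret spectral_gap L Q M \<gamma> \<rho> \<Gamma> L1 L2 \<sigma>
    by unfold_locales (fact assms)+
  have nX: "adapted_norm \<Gamma> L Q \<gamma> \<rho> = nX"
    by (intro ext) (simp add: adapted_norm_def nX_def nN_def nS_def)
  interpret semilinear_process L Q M \<gamma> \<rho> \<Gamma> L1 L2 \<sigma> f T
    by unfold_locales (use assms in \<open>auto simp: nX nN_def nS_def\<close>)
  obtain \<kappa> where \<kappa>: "admissible_slope \<kappa>" using slope_exists by blast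
  show ?thesis
    unfolding nX
  proof (intro exI[of _ stable] exI[of _ \<Theta>] exI[of _ \<kappa>] conjI allI impI)
    show "stable t = {\<eta>. bdd_above ((\<lambda>r. exp (\<sigma> * r) * nX r (T r t \<eta>)) ` {t..})}" for t
      by (rule stable_def)
    show "T t \<tau> ` stable \<tau> \<subseteq> stable t" if "\<tau> \<le> t" for t \<tau> using that by (rule stable_invariant)
    show "stable t = range (graph_map Q \<Theta> t)" for t by (rule stable_eq_range)
    show "\<Theta> t u = \<Theta> t (u - Q t u)" for t u by (rule \<Theta>_compl[symmetric])
    show "\<Theta> t u = Q t (\<Theta> t u)" for t u by (simp add: \<Theta>_def)
    show "\<Theta> t 0 = 0" for t by (rule \<Theta>_zero)
    show "0 < \<kappa>" "\<kappa> < L1 / L2 * ((\<gamma> - \<sigma>) / (\<sigma> - \<rho>))"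
      "\<gamma> - \<rho> = L1 * \<Gamma> (1, 1 / \<kappa>) + L2 * \<Gamma> (\<kappa>, 1)"
      using \<kappa> by (simp_all add: admissible_slope_def)
    show "N_norm L Q \<rho> t (\<Theta> t \<eta> - \<Theta> t \<eta>') \<le> \<kappa> * S_norm L \<gamma> t ((\<eta> - \<eta>') - Q t (\<eta> - \<eta>'))" for t \<eta> \<eta>'
      using \<Theta>_Lipschitz[OF \<kappa>] by (simp add: nS_def)
    show "nX t (T t \<tau> (graph_map Q \<Theta> \<tau> u)) \<le> \<Gamma> (\<kappa>, 1) / \<Gamma> (0, 1)
        * exp (- (\<gamma> - L2 * \<Gamma> (\<kappa>, 1)) * (t - \<tau>)) * nX \<tau> (graph_map Q \<Theta> \<tau> u)" if "\<tau> \<le> t" for t \<tau> u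
      unfolding graph_map_\<Theta> by (rule stable_decay[OF \<kappa> that lift(1)])
  qed
qed

end
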